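(* Every Hessian quantum field theory, with coupling space $\mathcal{T}$ and free energy $F(t,u)=F_0(t)+uF_1(t)+u^2F_2(t)+\cdots$, provides a family of para-Kähler vector bundles over $\mathcal{T}$ parameterized by the formal deformation parameter $u$, namely the bundles $(H_u,J,\boldsymbol{\omega}^S_u,\nabla_u)$ associated with the family of Legendre bundles of the theory; the classical case $u=0$ corresponds to the tree-level limit, i.e. to the Legendre bundle over $\mathcal{T}$ with potential $F_0$.
   Context: Conventions. $k$ is $\mathbb{R}$ or $\mathbb{C}$, and $D=\operatorname{Spec} k[[u]]$ is the formal disk with coordinate $u$. Objects over $\mathcal{T}\times D$ are smooth along $\mathcal{T}$ and formal in $u$: functions are formal power series in $u$ whose coefficients are smooth functions on $\mathcal{T}$ (tensored with $k$ if $k=\mathbb{C}$), and bundles, pairings and connections are defined over this ring. $C^\infty(\mathcal{T})$ denotes real-valued smooth functions. Statements "for each fixed $u$ (in the formal sense)" mean: treat $u$ as a constant parameter (so connections are differentiated only along $\mathcal{T}$) and require all identities as identities of formal power series in $u$. Strict convexity or positive definiteness of the Hessian of a formal series in $u$ means that the Hessian of its constant term is positive definite. Hessian QFT. A quantum field theory such that: (1) its coupling space $\mathcal{T}$ is an open convex subset of $\mathbb{R}^n$ (or more generally a smooth manifold with global affine coordinates $t^1,\dots,t^n$); (2) its free energy $F(t,u)=F_0(t)+uF_1(t)+u^2F_2(t)+\cdots$ is a formal power series in $u$ with coefficients in $C^\infty(\mathcal{T})$, strictly convex for each fixed $u$ in the formal sense; (3) the Hessian $g_{ij}(t,u)=\partial_i\partial_jF(t,u)$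 defines a positive-definite metric which, together with the affine structure on $\mathcal{T}$ and its dual, makes $\mathcal{T}$ a dually flat (Hessian) manifold for each fixed $u$ (a Riemannian metric $g$ with two torsion-free flat connections $\nabla^{\pm}$ on the tangent bundle satisfying $Z\,g(X,Y)=g(\nabla^+_ZX,Y)+g(X,\nabla^-_ZY)$, with local potentials $\Psi,\Psi^*$ related by $\Psi(\theta)+\Psi^*(\eta)=\langle\theta,\eta\rangle$ for $\eta=d\Psi(\theta)$). Only the data $(\mathcal{T},F)$ are used. The tree-level limit means setting $u=0$, where the free energy is $F_0$. Family of Legendre bundles of the theory. Let $\pi_{\mathcal{T}}:\mathcal{T}\times D\to\mathcal{T}$ be the projection. It is the quintuple $(H,\langle\!\langle\cdot,\cdot\rangle\!\rangle,\nabla^+,\nabla^-,\Psi)$ with $H=H^+\oplus H^-$, $H^+=\pi_{\mathcal{T}}^*T\mathcal{T}$, $H^-=\pi_{\mathcal{T}}^*T^*\mathcal{T}$; $\langle\!\langle X\oplus\alpha,Y\oplus\beta\rangle\!\rangle=\alpha(Y)+\beta(X)$; $\nabla^+$ the flat connection on $H^+$ for which the $\partial_i=\partial/\partial t^i$ are parallel; $\nabla^-$ the flat connection on $H^-$ induced by the dual affine coordinates $\eta_i=\partial_iF(t,u)$, i.e. for which the coframe $g(\partial/\partial\eta_i,\cdot)=dt^i$ is parallel; and $\Psi=F$. The Legendre bundle over $\mathcal{T}$ with potential $F_0$ is given by the same formulas over $\mathcal{T}$ (without $u$), with $F$ replaced by $F_0$. Associated bundles. For each fixed $u$ (in the formal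 sense), $H_u=H|_{\mathcal{T}\times\{u\}}$, $J=+\mathrm{id}$ on $H^+_u$ and $J=-\mathrm{id}$ on $H^-_u$, $\boldsymbol{\omega}^S_u(X,Y)=\langle\!\langle JX,Y\rangle\!\rangle$, $\nabla_u=\nabla^+_u\oplus\nabla^-_u$. Para-Kähler vector bundle over a smooth manifold $B$: a quadruple $(H,J,\boldsymbol{\omega}^S,\nabla)$ where $H$ is a real vector bundle over $B$ (for the formal family, where $B=\mathcal{T}$: a bundle over the ring of formal power series in $u$ whose coefficients are smooth functions on $\mathcal{T}$, tensored with $k$ if $k=\mathbb{C}$); $J$ is a vector bundle endomorphism of $H$ with $J^2=\mathrm{id}_H$ such that $\ker(J-\mathrm{id}_H)$ and $\ker(J+\mathrm{id}_H)$ have equal rank; $\boldsymbol{\omega}^S$ is a non-degenerate skew-symmetric bilinear form on the fibres of $H$ with $\boldsymbol{\omega}^S(JX,JY)=-\boldsymbol{\omega}^S(X,Y)$ for all $X,Y$; and $\nabla$ is a flat connection on $H$ with $\nabla J=0$ and $\nabla\boldsymbol{\omega}^S=0$. *)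

theory Defs
  imports "HOL-Analysis.Analysis" "HOL-Computational_Algebra.Formal_Power_Series"
begin

section \<open>Functions on the coupling space\<close>

text \<open>
  The coupling space is a set \<open>T\<close> with global coordinates \<open>t\<close>, injective on \<open>T\<close> with open image
  in \<open>real^'n\<close>; \<open>T\<close> carries the manifold structure with the single chart \<open>t\<close>. An open convex subset
  of \<open>real^'n\<close> is the case \<open>t = id\<close>.

  A base consists of the points and open sets of \<open>T\<close>, a ring of \<open>'K\<close>-valued functions over each
  open set, and the coordinate derivations. The values of a function outside the open set are
  irrelevant, so all identities below are stated at the points of that set only. The coefficient
  ring \<open>'K\<close> is \<open>'k\<close> for smooth \<open>'k\<close>-valued functions, and \<open>'k fps\<close> for formal power series in \<open>u\<close>
  whose coefficients are smooth \<open>'k\<close>-valued functions.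
\<close>

primrec Ck_on :: "nat \<Rightarrow> (real^'n \<Rightarrow> 'k::real_normed_vector) \<Rightarrow> (real^'n) set \<Rightarrow> bool" where
  "Ck_on 0 f S \<longleftrightarrow> continuous_on S f"
| "Ck_on (Suc m) f S \<longleftrightarrow> (\<forall>x\<in>S. f differentiable (at x)) \<and>
     (\<forall>i. Ck_on m (\<lambda>x. frechet_derivative f (at x) (axis i 1)) S)"

definition smooth_on :: "(real^'n) set \<Rightarrow> (real^'n \<Rightarrow> 'k::real_normed_vector) \<Rightarrow> bool" where
  "smooth_on S f \<longleftrightarrow> (\<forall>m. Ck_on m f S)"

record ('m, 'n, 'K) base =
  points :: "'m set"
  is_open :: "'m set \<Rightarrow> bool"
  smooth :: "'m set \<Rightarrow> ('m \<Rightarrow> 'K) set"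
  pderiv_at :: "'n \<Rightarrow> ('m \<Rightarrow> 'K) \<Rightarrow> 'm \<Rightarrow> 'K"

definition smooth_base ::
  "'m set \<Rightarrow> ('m \<Rightarrow> real^'n) \<Rightarrow> ('m, 'n::finite, 'k::real_normed_vector) base" where
  "smooth_base T t =
    \<lparr> points = T,
      is_open = (\<lambda>V. V \<subseteq> T \<and> open (t ` V)),
      smooth = (\<lambda>V. {f. smooth_on (t ` V) (f \<circ> the_inv_into T t)}),
      pderiv_at = (\<lambda>i f p. frechet_derivative (f \<circ> the_inv_into T t) (at (t p)) (axis i 1)) \<rparr>"

text \<open>The variable \<open>u\<close> is a constant for the derivations, which act coefficientwise.\<close>

definition formal_base ::
  "'m set \<Rightarrow> ('m \<Rightarrow> real^'n) \<Rightarrow> ('m, 'n::finite, 'k::real_normed_vector fps) base" where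
  "formal_base T t =
    \<lparr> points = T,
      is_open = (\<lambda>V. V \<subseteq> T \<and> open (t ` V)),
      smooth = (\<lambda>V. {f. \<forall>m. (\<lambda>p. fps_nth (f p) m) \<in> smooth (smooth_base T t) V}),
      pderiv_at = (\<lambda>i f p. Abs_fps (\<lambda>m. pderiv_at (smooth_base T t) i (\<lambda>q. fps_nth (f q) m) p)) \<rparr>"

text \<open>Vector vfields and 1-forms are given by their components with respect to
  \<open>\<partial>/\<partial>t\<^sup>i\<close> and \<open>dt\<^sup>i\<close>.\<close>

definition vfields :: "('m, 'n::finite, 'K) base \<Rightarrow> 'm set \<Rightarrow> ('m \<Rightarrow> 'K^'n) set" where
  "vfields B V = {X. \<forall>i. (\<lambda>p. X p $ i) \<in> smooth B V}"

definition act ::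
  "('m, 'n::finite, 'K::comm_ring_1) base \<Rightarrow> ('m \<Rightarrow> 'K^'n) \<Rightarrow> ('m \<Rightarrow> 'K) \<Rightarrow> 'm \<Rightarrow> 'K" where
  "act B X f p = (\<Sum>i\<in>UNIV. X p $ i * pderiv_at B i f p)"

definition lie_bracket ::
  "('m, 'n::finite, 'K::comm_ring_1) base \<Rightarrow> ('m \<Rightarrow> 'K^'n) \<Rightarrow> ('m \<Rightarrow> 'K^'n) \<Rightarrow> 'm \<Rightarrow> 'K^'n" where
  "lie_bracket B X Y p = (\<chi> i. act B X (\<lambda>q. Y q $ i) p - act B Y (\<lambda>q. X q $ i) p)"


section \<open>Vector bundles and connections over a base\<close>

text \<open>The fibres are submodules of an ambient \<open>'K\<close>-module, and the smooth structure is given by the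
  sheaf of smooth sections.\<close>

record ('m, 'K, 'e) vbundle =
  scale :: "'K \<Rightarrow> 'e \<Rightarrow> 'e"
  fibre :: "'m \<Rightarrow> 'e set"
  sections :: "'m set \<Rightarrow> ('m \<Rightarrow> 'e) set"

definition is_basis ::
  "('K::comm_ring_1 \<Rightarrow> 'e::ab_group_add \<Rightarrow> 'e) \<Rightarrow> 'e set \<Rightarrow> nat \<Rightarrow> (nat \<Rightarrow> 'e) \<Rightarrow> bool" where
  "is_basis sc S r b \<longleftrightarrow> inj_on b {..<r} \<and> \<not> module.dependent sc (b ` {..<r}) \<and>
     module.span sc (b ` {..<r}) = S"

definition local_frame ::
  "('m, 'n::finite, 'K::comm_ring_1) base \<Rightarrow> ('m, 'K, 'e::ab_group_add) vbundle \<Rightarrow>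
    'm set \<Rightarrow> nat \<Rightarrow> (nat \<Rightarrow> 'm \<Rightarrow> 'e) \<Rightarrow> bool" where
  "local_frame B E V r e \<longleftrightarrow>
     (\<forall>q\<in>V. is_basis (scale E) (fibre E q) r (\<lambda>i. e i q)) \<and>
     (\<forall>W s. is_open B W \<and> W \<subseteq> V \<longrightarrow>
        (s \<in> sections E W \<longleftrightarrow>
          (\<exists>a. (\<forall>i<r. a i \<in> smooth B W) \<and> (\<forall>q\<in>W. s q = (\<Sum>i<r. scale E (a i q) (e i q))))))"

definition vector_bundle ::
  "('m, 'n::finite, 'K::comm_ring_1) base \<Rightarrow> ('m, 'K, 'e::ab_group_add) vbundle \<Rightarrow> bool" where
  "vector_bundle B E \<longleftrightarrow>
     module (scale E) \<and>
     (\<forall>p\<in>points B. module.subspace (scale E) (fibre E p)) \<and>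
     (\<forall>V s. is_open B V \<and> s \<in> sections E V \<longrightarrow> (\<forall>p\<in>V. s p \<in> fibre E p)) \<and>
     (\<forall>V W. is_open B V \<and> is_open B W \<and> W \<subseteq> V \<longrightarrow> sections E V \<subseteq> sections E W) \<and>
     (\<forall>V s. is_open B V \<and> (\<forall>p\<in>V. \<exists>W. is_open B W \<and> p \<in> W \<and> W \<subseteq> V \<and> s \<in> sections E W)
        \<longrightarrow> s \<in> sections E V) \<and>
     (\<forall>p\<in>points B. \<exists>V r e. is_open B V \<and> p \<in> V \<and> local_frame B E V r e)"

text \<open>A connection is a covariant derivative on global sections, taken along vector vfields of the
  coupling space only.\<close>

type_synonym ('m, 'n, 'K, 'e) covd = "('m \<Rightarrow> 'K^'n) \<Rightarrow> ('m \<Rightarrow> 'e) \<Rightarrow> 'm \<Rightarrow> 'e"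

definition is_connection ::
  "('m, 'n::finite, 'K::comm_ring_1) base \<Rightarrow> ('m, 'K, 'e::ab_group_add) vbundle \<Rightarrow>
    ('m, 'n, 'K, 'e) covd \<Rightarrow> bool" where
  "is_connection B E D \<longleftrightarrow>
    (\<forall>X\<in>vfields B (points B). \<forall>s\<in>sections E (points B). D X s \<in> sections E (points B)) \<and>
    (\<forall>X\<in>vfields B (points B). \<forall>Y\<in>vfields B (points B). \<forall>s\<in>sections E (points B). \<forall>p\<in>points B.
       D (\<lambda>q. X q + Y q) s p = D X s p + D Y s p) \<and>
    (\<forall>f\<in>smooth B (points B). \<forall>X\<in>vfields B (points B). \<forall>s\<in>sections E (points B). \<forall>p\<in>points B.
       D (\<lambda>q. f q *s X q) s p = scale E (f p) (D X s p)) \<and>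
    (\<forall>X\<in>vfields B (points B). \<forall>s\<in>sections E (points B). \<forall>s'\<in>sections E (points B). \<forall>p\<in>points B.
       D X (\<lambda>q. s q + s' q) p = D X s p + D X s' p) \<and>
    (\<forall>X\<in>vfields B (points B). \<forall>f\<in>smooth B (points B). \<forall>s\<in>sections E (points B). \<forall>p\<in>points B.
       D X (\<lambda>q. scale E (f q) (s q)) p = scale E (act B X f p) (s p) + scale E (f p) (D X s p))"

definition flat_connection ::
  "('m, 'n::finite, 'K::comm_ring_1) base \<Rightarrow> ('m, 'K, 'e::ab_group_add) vbundle \<Rightarrow>
    ('m, 'n, 'K, 'e) covd \<Rightarrow> bool" where
  "flat_connection B E D \<longleftrightarrow>
    (\<forall>X\<in>vfields B (points B). \<forall>Y\<in>vfields B (points B). \<forall>s\<in>sections E (points B). \<forall>p\<in>points B.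
       D X (D Y s) p - D Y (D X s) p - D (lie_bracket B X Y) s p = 0)"

definition tangent_bundle ::
  "('m, 'n::finite, 'K::comm_ring_1) base \<Rightarrow> ('m, 'K, 'K^'n) vbundle" where
  "tangent_bundle B = \<lparr> scale = (*s), fibre = (\<lambda>p. UNIV), sections = vfields B \<rparr>"

text \<open>Same data as the tangent bundle, the components now being those with respect to \<open>dt\<^sup>i\<close>.\<close>

definition cotangent_bundle ::
  "('m, 'n::finite, 'K::comm_ring_1) base \<Rightarrow> ('m, 'K, 'K^'n) vbundle" where
  "cotangent_bundle B = \<lparr> scale = (*s), fibre = (\<lambda>p. UNIV), sections = vfields B \<rparr>"

definition direct_sum ::
  "('m, 'K, 'e) vbundle \<Rightarrow> ('m, 'K, 'f) vbundle \<Rightarrow> ('m, 'K, 'e \<times> 'f) vbundle" where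
  "direct_sum E E' =
    \<lparr> scale = (\<lambda>c (v, w). (scale E c v, scale E' c w)),
      fibre = (\<lambda>p. fibre E p \<times> fibre E' p),
      sections = (\<lambda>V. {s. fst \<circ> s \<in> sections E V \<and> snd \<circ> s \<in> sections E' V}) \<rparr>"

text \<open>The connection, on a bundle with fibres \<open>'K^'n\<close>, for which a given global frame is parallel:
  \<open>D X (\<Sum>i. a i * e i) = (\<Sum>i. X (a i) * e i)\<close>.\<close>

definition frame_coeffs :: "('n::finite \<Rightarrow> 'K::comm_ring_1^'n) \<Rightarrow> 'K^'n \<Rightarrow> 'K^'n" where
  "frame_coeffs b v = (THE a. v = (\<Sum>i\<in>UNIV. a $ i *s b i))"

definition parallel_frame_connection ::
  "('m, 'n::finite, 'K::comm_ring_1) base \<Rightarrow> ('n \<Rightarrow> 'm \<Rightarrow> 'K^'n) \<Rightarrow> ('m, 'n, 'K, 'K^'n) covd" where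
  "parallel_frame_connection B e X s p =
     (\<Sum>i\<in>UNIV. act B X (\<lambda>q. frame_coeffs (\<lambda>j. e j q) (s q) $ i) p *s e i p)"


section \<open>Para-Kaehler vector bundles\<close>

record ('m, 'n, 'K, 'e) pk_data =
  pk_bundle :: "('m, 'K, 'e) vbundle"
  pk_J :: "'m \<Rightarrow> 'e \<Rightarrow> 'e"
  pk_omega :: "'m \<Rightarrow> 'e \<Rightarrow> 'e \<Rightarrow> 'K"
  pk_conn :: "('m, 'n, 'K, 'e) covd"

definition bundle_endomorphism ::
  "('m, 'n::finite, 'K::comm_ring_1) base \<Rightarrow> ('m, 'K, 'e::ab_group_add) vbundle \<Rightarrow>
    ('m \<Rightarrow> 'e \<Rightarrow> 'e) \<Rightarrow> bool" where
  "bundle_endomorphism B E J \<longleftrightarrow>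
    (\<forall>p\<in>points B. \<forall>v\<in>fibre E p. J p v \<in> fibre E p \<and>
       (\<forall>w\<in>fibre E p. J p (v + w) = J p v + J p w) \<and>
       (\<forall>c. J p (scale E c v) = scale E c (J p v))) \<and>
    (\<forall>s\<in>sections E (points B). (\<lambda>p. J p (s p)) \<in> sections E (points B))"

definition linear_functional ::
  "('m, 'K::comm_ring_1, 'e::ab_group_add) vbundle \<Rightarrow> 'm \<Rightarrow> ('e \<Rightarrow> 'K) \<Rightarrow> bool" where
  "linear_functional E p f \<longleftrightarrow>
    (\<forall>v\<in>fibre E p. (\<forall>w\<in>fibre E p. f (v + w) = f v + f w) \<and> (\<forall>c. f (scale E c v) = c * f v))"

definition bilinear_form ::
  "('m, 'n::finite, 'K::comm_ring_1) base \<Rightarrow> ('m, 'K, 'e::ab_group_add) vbundle \<Rightarrow>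
    ('m \<Rightarrow> 'e \<Rightarrow> 'e \<Rightarrow> 'K) \<Rightarrow> bool" where
  "bilinear_form B E w \<longleftrightarrow>
    (\<forall>p\<in>points B. \<forall>v\<in>fibre E p.
       linear_functional E p (w p v) \<and> linear_functional E p (\<lambda>v'. w p v' v)) \<and>
    (\<forall>s\<in>sections E (points B). \<forall>s'\<in>sections E (points B).
       (\<lambda>p. w p (s p) (s' p)) \<in> smooth B (points B))"

text \<open>Over a coefficient ring that is not a field, non-degeneracy means that the induced map to the
  dual is an isomorphism on each fibre.\<close>

definition nondegenerate ::
  "('m, 'n::finite, 'K::comm_ring_1) base \<Rightarrow> ('m, 'K, 'e::ab_group_add) vbundle \<Rightarrow>
    ('m \<Rightarrow> 'e \<Rightarrow> 'e \<Rightarrow> 'K) \<Rightarrow> bool" where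
  "nondegenerate B E w \<longleftrightarrow>
    (\<forall>p\<in>points B. \<forall>f. linear_functional E p f \<longrightarrow>
       (\<exists>!v. v \<in> fibre E p \<and> (\<forall>v'\<in>fibre E p. w p v v' = f v')))"

definition para_kaehler_bundle ::
  "('m, 'n::finite, 'K::comm_ring_1) base \<Rightarrow> ('m, 'n, 'K, 'e::ab_group_add) pk_data \<Rightarrow> bool" where
  "para_kaehler_bundle B P \<longleftrightarrow>
    (let E = pk_bundle P; J = pk_J P; w = pk_omega P; D = pk_conn P; T = points B in
     vector_bundle B E \<and>
     bundle_endomorphism B E J \<and>
     (\<forall>p\<in>T. \<forall>v\<in>fibre E p. J p (J p v) = v) \<and>
     (\<forall>p\<in>T. \<exists>r b b'. is_basis (scale E) {v \<in> fibre E p. J p v = v} r b \<and>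
                       is_basis (scale E) {v \<in> fibre E p. J p v = - v} r b') \<and>
     bilinear_form B E w \<and>
     nondegenerate B E w \<and>
     (\<forall>p\<in>T. \<forall>v\<in>fibre E p. \<forall>v'\<in>fibre E p. w p v v' = - w p v' v) \<and>
     (\<forall>p\<in>T. \<forall>v\<in>fibre E p. \<forall>v'\<in>fibre E p. w p (J p v) (J p v') = - w p v v') \<and>
     is_connection B E D \<and>
     flat_connection B E D \<and>
     (\<forall>X\<in>vfields B T. \<forall>s\<in>sections E T. \<forall>p\<in>T. D X (\<lambda>q. J q (s q)) p = J p (D X s p)) \<and>
     (\<forall>X\<in>vfields B T. \<forall>s\<in>sections E T. \<forall>s'\<in>sections E T. \<forall>p\<in>T.
        act B X (\<lambda>q. w q (s q) (s' q)) p = w p (D X s p) (s' p) + w p (s p) (D X s' p)))"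


section \<open>Legendre bundles\<close>

definition eta :: "('m, 'n, 'K) base \<Rightarrow> ('m \<Rightarrow> 'K) \<Rightarrow> 'n \<Rightarrow> 'm \<Rightarrow> 'K" where
  "eta B F i = pderiv_at B i F"

definition hessian :: "('m, 'n::finite, 'K) base \<Rightarrow> ('m \<Rightarrow> 'K) \<Rightarrow> 'm \<Rightarrow> 'K^'n^'n" where
  "hessian B F p = (\<chi> i j. pderiv_at B i (pderiv_at B j F) p)"

definition hessian_metric ::
  "('m, 'n::finite, 'K::comm_ring_1) base \<Rightarrow> ('m \<Rightarrow> 'K) \<Rightarrow> 'm \<Rightarrow> 'K^'n \<Rightarrow> 'K^'n \<Rightarrow> 'K" where
  "hessian_metric B F p v w = (\<Sum>i\<in>UNIV. \<Sum>j\<in>UNIV. hessian B F p $ i $ j * v $ i * w $ j)"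

text \<open>\<open>\<partial>/\<partial>\<eta>\<^sub>i\<close> is the \<open>i\<close>-th column of the inverse of the Jacobian matrix of \<open>\<eta>\<close> with respect to \<open>t\<close>.\<close>

definition d_eta ::
  "('m, 'n::finite, 'K::comm_ring_1) base \<Rightarrow> ('m \<Rightarrow> 'K) \<Rightarrow> 'n \<Rightarrow> 'm \<Rightarrow> 'K^'n" where
  "d_eta B F i p = column i (matrix_inv (\<chi> j k. pderiv_at B k (eta B F j) p))"

text \<open>The 1-form \<open>g(\<partial>/\<partial>\<eta>\<^sub>i, \<cdot>)\<close>.\<close>

definition dual_coframe ::
  "('m, 'n::finite, 'K::comm_ring_1) base \<Rightarrow> ('m \<Rightarrow> 'K) \<Rightarrow> 'n \<Rightarrow> 'm \<Rightarrow> 'K^'n" where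
  "dual_coframe B F i p = (\<chi> j. hessian_metric B F p (d_eta B F i p) (axis j 1))"

definition affine_connection ::
  "('m, 'n::finite, 'K::comm_ring_1) base \<Rightarrow> ('m, 'n, 'K, 'K^'n) covd" where
  "affine_connection B = parallel_frame_connection B (\<lambda>i p. axis i 1)"

record ('m, 'n, 'K) legendre_data =
  H_plus :: "('m, 'K, 'K^'n) vbundle"
  H_minus :: "('m, 'K, 'K^'n) vbundle"
  l_pairing :: "'m \<Rightarrow> ('K^'n) \<times> ('K^'n) \<Rightarrow> ('K^'n) \<times> ('K^'n) \<Rightarrow> 'K"
  nabla_plus :: "('m, 'n, 'K, 'K^'n) covd"
  nabla_minus :: "('m, 'n, 'K, 'K^'n) covd"
  l_potential :: "'m \<Rightarrow> 'K"

definition legendre_bundle ::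
  "('m, 'n::finite, 'K::comm_ring_1) base \<Rightarrow> ('m \<Rightarrow> 'K) \<Rightarrow> ('m, 'n, 'K) legendre_data" where
  "legendre_bundle B F =
    \<lparr> H_plus = tangent_bundle B,
      H_minus = cotangent_bundle B,
      l_pairing = (\<lambda>p (X, \<alpha>) (Y, \<beta>). (\<Sum>i\<in>UNIV. \<alpha> $ i * Y $ i) + (\<Sum>i\<in>UNIV. \<beta> $ i * X $ i)),
      nabla_plus = affine_connection B,
      nabla_minus = parallel_frame_connection B (dual_coframe B F),
      l_potential = F \<rparr>"

definition associated_pk ::
  "('m, 'n::finite, 'K::comm_ring_1) legendre_data \<Rightarrow> ('m, 'n, 'K, ('K^'n) \<times> ('K^'n)) pk_data" where
  "associated_pk L =
    \<lparr> pk_bundle = direct_sum (H_plus L) (H_minus L),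
      pk_J = (\<lambda>p (X, \<alpha>). (X, - \<alpha>)),
      pk_omega = (\<lambda>p v w. l_pairing L p ((\<lambda>(X, \<alpha>). (X, - \<alpha>)) v) w),
      pk_conn = (\<lambda>Z s p. (nabla_plus L Z (fst \<circ> s) p, nabla_minus L Z (snd \<circ> s) p)) \<rparr>"


section \<open>Hessian quantum field theories\<close>

text \<open>Positive definiteness of a formal family of matrices or bilinear forms refers to the constant
  term in \<open>u\<close>.\<close>

definition formally_strictly_convex ::
  "'m set \<Rightarrow> ('m \<Rightarrow> real^'n::finite) \<Rightarrow> ('m \<Rightarrow> real fps) \<Rightarrow> bool" where
  "formally_strictly_convex T t F \<longleftrightarrow>
    (\<forall>p\<in>T. \<forall>v::real^'n. v \<noteq> 0 \<longrightarrow>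
       0 < v \<bullet> ((\<chi> i j. fps_nth (hessian (formal_base T t) F p $ i $ j) 0) *v v))"

definition formal_riemannian_metric ::
  "('m, 'n::finite, real fps) base \<Rightarrow> ('m \<Rightarrow> real fps^'n \<Rightarrow> real fps^'n \<Rightarrow> real fps) \<Rightarrow> bool" where
  "formal_riemannian_metric B g \<longleftrightarrow>
    bilinear_form B (tangent_bundle B) g \<and>
    (\<forall>p\<in>points B. \<forall>v w. g p v w = g p w v) \<and>
    (\<forall>p\<in>points B. \<forall>v::real^'n. v \<noteq> 0 \<longrightarrow>
       0 < fps_nth (g p (\<chi> i. fps_const (v $ i)) (\<chi> i. fps_const (v $ i))) 0)"

definition torsion_free ::
  "('m, 'n::finite, 'K::comm_ring_1) base \<Rightarrow> ('m, 'n, 'K, 'K^'n) covd \<Rightarrow> bool" where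
  "torsion_free B D \<longleftrightarrow>
    (\<forall>X\<in>vfields B (points B). \<forall>Y\<in>vfields B (points B). \<forall>p\<in>points B.
       D X Y p - D Y X p = lie_bracket B X Y p)"

text \<open>Functions \<open>\<theta> i\<close> are affine coordinates of \<open>D\<close> if their differentials form a coframe which is
  parallel for the connection dual to \<open>D\<close> on 1-forms.\<close>

definition affine_coordinates ::
  "('m, 'n::finite, 'K::comm_ring_1) base \<Rightarrow> 'm set \<Rightarrow> ('m, 'n, 'K, 'K^'n) covd \<Rightarrow>
    ('n \<Rightarrow> 'm \<Rightarrow> 'K) \<Rightarrow> bool" where
  "affine_coordinates B V D \<theta> \<longleftrightarrow>
    (\<forall>i. \<theta> i \<in> smooth B V) \<and>
    (\<forall>q\<in>V. invertible (\<chi> i j. pderiv_at B j (\<theta> i) q)) \<and>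
    (\<forall>X\<in>vfields B (points B). \<forall>Y\<in>vfields B (points B). \<forall>i. \<forall>q\<in>V.
       act B X (act B Y (\<theta> i)) q = act B (D X Y) (\<theta> i) q)"

text \<open>The last clause gives the local potentials: \<open>\<eta> = d\<Psi>(\<theta>)\<close>, \<open>\<Psi>(\<theta>) + \<Psi>*(\<eta>) = \<langle>\<theta>, \<eta>\<rangle>\<close>, and \<open>g\<close> is the
  Hessian of \<open>\<Psi>\<close> in the coordinates \<open>\<theta>\<close>. Both potentials are given as functions on the coupling
  space, that is, \<open>\<Psi>s\<close> stands for \<open>\<Psi>* \<circ> \<eta>\<close>.\<close>

definition dually_flat ::
  "('m, 'n::finite, real fps) base \<Rightarrow> ('m \<Rightarrow> real fps^'n \<Rightarrow> real fps^'n \<Rightarrow> real fps) \<Rightarrow>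
    ('m, 'n, real fps, real fps^'n) covd \<Rightarrow> ('m, 'n, real fps, real fps^'n) covd \<Rightarrow> bool" where
  "dually_flat B g Dp Dm \<longleftrightarrow>
    formal_riemannian_metric B g \<and>
    (\<forall>D\<in>{Dp, Dm}. is_connection B (tangent_bundle B) D \<and> flat_connection B (tangent_bundle B) D \<and>
       torsion_free B D) \<and>
    (\<forall>X\<in>vfields B (points B). \<forall>Y\<in>vfields B (points B). \<forall>Z\<in>vfields B (points B). \<forall>p\<in>points B.
       act B Z (\<lambda>q. g q (X q) (Y q)) p = g p (Dp Z X p) (Y p) + g p (X p) (Dm Z Y p)) \<and>
    (\<forall>p\<in>points B. \<exists>V \<theta> \<eta> \<Psi> \<Psi>s.
       is_open B V \<and> p \<in> V \<and> affine_coordinates B V Dp \<theta> \<and> affine_coordinates B V Dm \<eta> \<and>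
       \<Psi> \<in> smooth B V \<and> \<Psi>s \<in> smooth B V \<and>
       (\<forall>q\<in>V. (\<forall>j. pderiv_at B j \<Psi> q = (\<Sum>i\<in>UNIV. \<eta> i q * pderiv_at B j (\<theta> i) q)) \<and>
              \<Psi> q + \<Psi>s q = (\<Sum>i\<in>UNIV. \<theta> i q * \<eta> i q) \<and>
              (\<forall>v w. g q v w =
                 (\<Sum>i\<in>UNIV. (\<Sum>j\<in>UNIV. v $ j * pderiv_at B j (\<theta> i) q) *
                            (\<Sum>j\<in>UNIV. w $ j * pderiv_at B j (\<eta> i) q)))))"

definition hessian_qft ::
  "'m set \<Rightarrow> ('m \<Rightarrow> real^'n::finite) \<Rightarrow> ('m \<Rightarrow> real fps) \<Rightarrow> bool" where
  "hessian_qft T t F \<longleftrightarrow>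
    inj_on t T \<and> open (t ` T) \<and>
    F \<in> smooth (formal_base T t) T \<and>
    formally_strictly_convex T t F \<and>
    (\<exists>Dm. dually_flat (formal_base T t) (hessian_metric (formal_base T t) F)
            (affine_connection (formal_base T t)) Dm)"

text \<open>In the following, \<open>'k\<close> is \<open>real\<close> or \<open>complex\<close>, the only commutative vfields (up to isomorphism)
  in the sort \<open>{real_normed_field, euclidean_space}\<close>.\<close>

definition legendre_family ::
  "'m set \<Rightarrow> ('m \<Rightarrow> real^'n::finite) \<Rightarrow> ('m \<Rightarrow> real fps) \<Rightarrow>
    ('m, 'n, 'k::{real_normed_field, euclidean_space} fps) legendre_data" where
  "legendre_family T t F =
     legendre_bundle (formal_base T t) (\<lambda>p. Abs_fps (\<lambda>m. of_real (fps_nth (F p) m)))"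

definition tree_level_legendre_bundle ::
  "'m set \<Rightarrow> ('m \<Rightarrow> real^'n::finite) \<Rightarrow> ('m \<Rightarrow> real fps) \<Rightarrow>
    ('m, 'n, 'k::{real_normed_field, euclidean_space}) legendre_data" where
  "tree_level_legendre_bundle T t F =
     legendre_bundle (smooth_base T t) (\<lambda>p. of_real (fps_nth (F p) 0))"


section \<open>Restriction to \<open>u = 0\<close>\<close>

definition at_0 :: "'k::zero fps^'n \<Rightarrow> 'k^'n::finite" where
  "at_0 v = (\<chi> i. fps_nth (v $ i) 0)"

text \<open>\<open>E0\<close> is the restriction of \<open>E\<close> to \<open>u = 0\<close>, with \<open>r\<close> inducing \<open>E / u E \<cong> E0\<close>.\<close>

definition restricts_at_0 ::
  "('m, 'n::finite, 'k::comm_ring_1 fps) base \<Rightarrow> ('e \<Rightarrow> 'f) \<Rightarrow>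
    ('m, 'k fps, 'e::ab_group_add) vbundle \<Rightarrow> ('m, 'k, 'f::ab_group_add) vbundle \<Rightarrow> bool" where
  "restricts_at_0 B r E E0 \<longleftrightarrow>
    (\<forall>p\<in>points B.
       r ` fibre E p = fibre E0 p \<and>
       (\<forall>v\<in>fibre E p. \<forall>w\<in>fibre E p. r (v + w) = r v + r w) \<and>
       (\<forall>c. \<forall>v\<in>fibre E p. r (scale E c v) = scale E0 (fps_nth c 0) (r v)) \<and>
       (\<forall>v\<in>fibre E p. r v = 0 \<longleftrightarrow> (\<exists>w\<in>fibre E p. v = scale E fps_X w))) \<and>
    (\<forall>V. is_open B V \<longrightarrow>
       (\<forall>s\<in>sections E V. r \<circ> s \<in> sections E0 V) \<and>
       (\<forall>s0\<in>sections E0 V. \<exists>s\<in>sections E V. \<forall>p\<in>V. r (s p) = s0 p))"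

definition connection_restricts_at_0 ::
  "('m, 'n::finite, 'k::comm_ring_1 fps) base \<Rightarrow> ('e \<Rightarrow> 'f) \<Rightarrow> ('m, 'k fps, 'e) vbundle \<Rightarrow>
    ('m, 'n, 'k fps, 'e) covd \<Rightarrow> ('m, 'n, 'k, 'f) covd \<Rightarrow> bool" where
  "connection_restricts_at_0 B r E D D0 \<longleftrightarrow>
    (\<forall>X\<in>vfields B (points B). \<forall>s\<in>sections E (points B). \<forall>p\<in>points B.
       r (D X s p) = D0 (at_0 \<circ> X) (r \<circ> s) p)"

definition legendre_restricts_at_0 ::
  "('m, 'n::finite, 'k::comm_ring_1 fps) base \<Rightarrow>
    ('m, 'n, 'k fps) legendre_data \<Rightarrow> ('m, 'n, 'k) legendre_data \<Rightarrow> bool" where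
  "legendre_restricts_at_0 B L L0 \<longleftrightarrow>
    restricts_at_0 B at_0 (H_plus L) (H_plus L0) \<and>
    restricts_at_0 B at_0 (H_minus L) (H_minus L0) \<and>
    (\<forall>p\<in>points B. \<forall>v\<in>fibre (direct_sum (H_plus L) (H_minus L)) p.
       \<forall>w\<in>fibre (direct_sum (H_plus L) (H_minus L)) p.
       fps_nth (l_pairing L p v w) 0 =
         l_pairing L0 p (map_prod at_0 at_0 v) (map_prod at_0 at_0 w)) \<and>
    connection_restricts_at_0 B at_0 (H_plus L) (nabla_plus L) (nabla_plus L0) \<and>
    connection_restricts_at_0 B at_0 (H_minus L) (nabla_minus L) (nabla_minus L0) \<and>
    (\<forall>p\<in>points B. fps_nth (l_potential L p) 0 = l_potential L0 p)"

definition pk_restricts_at_0 ::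
  "('m, 'n::finite, 'k::comm_ring_1 fps) base \<Rightarrow> ('e \<Rightarrow> 'f) \<Rightarrow>
    ('m, 'n, 'k fps, 'e::ab_group_add) pk_data \<Rightarrow> ('m, 'n, 'k, 'f::ab_group_add) pk_data \<Rightarrow>
    bool" where
  "pk_restricts_at_0 B r P P0 \<longleftrightarrow>
    restricts_at_0 B r (pk_bundle P) (pk_bundle P0) \<and>
    (\<forall>p\<in>points B. \<forall>v\<in>fibre (pk_bundle P) p.
       r (pk_J P p v) = pk_J P0 p (r v) \<and>
       (\<forall>w\<in>fibre (pk_bundle P) p. fps_nth (pk_omega P p v w) 0 = pk_omega P0 p (r v) (r w))) \<and>
    connection_restricts_at_0 B r (pk_bundle P) (pk_conn P) (pk_conn P0)"

end

theory Submission
  imports Defs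
begin

text \<open>
  Since \<open>\<eta>\<^sub>i = \<partial>\<^sub>i F\<close>, the fields \<open>\<partial>/\<partial>\<eta>\<^sub>i\<close> are the columns of the inverse Hessian, so
  \<open>g(\<partial>/\<partial>\<eta>\<^sub>i, \<cdot>) = dt\<^sup>i\<close>. Hence both \<open>\<nabla>\<^sup>+\<close> and \<open>\<nabla>\<^sup>-\<close> act componentwise in the coordinate frames, and
  with respect to these frames \<open>J\<close> and the symplectic form have constant coefficients. Flatness is
  the commutation of partial derivatives, and \<open>\<nabla>J = 0\<close>, \<open>\<nabla>\<omega> = 0\<close> are the linearity and the Leibniz
  rule. The argument uses only formal properties of the derivations, so it applies to smooth
  functions and to formal power series in \<open>u\<close> alike; taking constant terms in \<open>u\<close> commutes with
  every construction.
\<close>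

section \<open>Calculus of iterated partial derivatives\<close>

text \<open>The formula for the dual coframe needs an inverse of the Hessian with entries in
  \<open>'k fps\<close>, and \<open>matrix_inv\<close> is a choice that says nothing before an
  inverse is known to exist. An inverse over \<open>real fps\<close> is read off from the local
  potentials contained in \<open>dually_flat\<close>; the ring homomorphisms from
  \<open>real fps\<close> to \<open>'k fps\<close>, and from there to the constant term, carry
  invertibility to the family and to the tree level. The other obstacle is undetermined values.
  \<open>frechet_derivative\<close> is a choice too, so sum and product rules hold only for smooth
  functions, and the dual coframe is known only at points of \<open>T\<close>. Every identity is
  therefore confined to these points, and a derivative of a function known only on \<open>T\<close>
  is rewritten by a congruence rule that rests on the openness of the image of
  \<open>T\<close>.\<close>

definition partial :: "'n::finite \<Rightarrow> (real^'n \<Rightarrow> 'k::real_normed_vector) \<Rightarrow> real^'n \<Rightarrow> 'k" where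
  "partial i f x = frechet_derivative f (at x) (axis i 1)"

lemma Ck_on_Suc:
  "Ck_on (Suc m) f S \<longleftrightarrow> (\<forall>x\<in>S. f differentiable (at x)) \<and> (\<forall>i. Ck_on m (partial i f) S)"
  by (simp add: partial_def[abs_def])

declare Ck_on.simps(2) [simp del] Ck_on_Suc [simp]

lemma partial_eqI: "(f has_derivative f') (at x) \<Longrightarrow> partial i f x = f' (axis i 1)"
  by (simp add: partial_def flip: frechet_derivative_at)

text \<open>Differentiability is not assumed: \<open>frechet_derivative\<close> chooses from the set
  of derivatives, and functions that agree near \<open>x\<close> have the same set, so even
  undetermined values coincide.\<close>

lemma frechet_derivative_cong_open:
  assumes "open S" "x \<in> S" "\<And>y. y \<in> S \<Longrightarrow> f y = g y"
  shows "frechet_derivative f (at x) = frechet_derivative g (at x)"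
proof -
  have "(f has_derivative D) (at x) \<longleftrightarrow> (g has_derivative D) (at x)" for D
    using assms has_derivative_transform_within_open[of f D x UNIV S g]
      has_derivative_transform_within_open[of g D x UNIV S f] by auto
  then show ?thesis by (simp add: frechet_derivative_def)
qed

lemma partial_cong_open:
  "open S \<Longrightarrow> x \<in> S \<Longrightarrow> (\<And>y. y \<in> S \<Longrightarrow> f y = g y) \<Longrightarrow> partial i f x = partial i g x"
  unfolding partial_def by (subst frechet_derivative_cong_open[of S x f g]) auto

lemma Ck_on_cong:
  assumes "open S" "\<And>x. x \<in> S \<Longrightarrow> f x = g x" "Ck_on m f S"
  shows "Ck_on m g S"
  using assms(2,3)
proof (induction m arbitrary: f g)
  case 0
  then show ?case using continuous_on_cong[of S S f g] by simp
next
  case (Suc m)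
  have "g differentiable (at x)" if "x \<in> S" for x
  proof -
    have "f differentiable (at x)" using Suc.prems(2) that by simp
    then obtain D where "(f has_derivative D) (at x)" unfolding differentiable_def ..
    then have "(g has_derivative D) (at x)"
      by (rule has_derivative_transform_within_open[OF _ assms(1) that]) (simp add: Suc.prems(1))
    then show ?thesis by (rule differentiableI)
  qed
  moreover have "Ck_on m (partial i g) S" for i
    using Suc.prems(2) partial_cong_open[OF assms(1) _ Suc.prems(1)]
    by (intro Suc.IH[of "partial i f" "partial i g"]) auto
  ultimately show ?case by simp
qed

text \<open>At the bottom of the recursion this is continuity of differentiable functions. The
  product rule depends on it, because there undifferentiated factors stand beside derivatives and
  must have the lower order as well.\<close>

lemma Ck_on_SucD: "Ck_on (Suc m) f S \<Longrightarrow> Ck_on m f S"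
proof (induction m arbitrary: f)
  case 0
  then show ?case
    by (simp add: continuous_at_imp_continuous_on differentiable_imp_continuous_within)
next
  case (Suc m)
  have "Ck_on m (partial i f) S" for i
    using Suc.prems by (intro Suc.IH) simp
  with Suc.prems show ?case by simp
qed

lemma Ck_on_subset: "Ck_on m f S \<Longrightarrow> S' \<subseteq> S \<Longrightarrow> Ck_on m f S'"
proof (induction m arbitrary: f)
  case 0
  then show ?case by (simp add: continuous_on_subset)
qed auto

text \<open>Continuity and differentiability at a point are decided on a neighbourhood, so every
  level of the recursion is local. This becomes the gluing axiom for functions, and later for
  sections.\<close>

lemma Ck_on_local:
  assumes "open S" "\<And>x. x \<in> S \<Longrightarrow> \<exists>S'. open S' \<and> x \<in> S' \<and> Ck_on m f S'"
  shows "Ck_on m f S"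
  using assms(2)
proof (induction m arbitrary: f)
  case 0
  have "isCont f x" if "x \<in> S" for x
    using 0[OF that] by (auto simp: continuous_on_eq_continuous_at)
  then show ?case by (simp add: continuous_at_imp_continuous_on)
next
  case (Suc m)
  have "f differentiable (at x)" if "x \<in> S" for x
    using Suc.prems[OF that] by auto
  moreover have "Ck_on m (partial i f) S" for i
  proof (rule Suc.IH)
    fix x assume "x \<in> S"
    from Suc.prems[OF this] show "\<exists>S'. open S' \<and> x \<in> S' \<and> Ck_on m (partial i f) S'"
      by auto
  qed
  ultimately show ?case by simp
qed

lemma Ck_on_const: "Ck_on m (\<lambda>x. c) S"
proof (induction m arbitrary: c)
  case (Suc m)
  have "partial i (\<lambda>x. c) = (\<lambda>x. 0)" for i :: 'a and c :: 'b
    by (simp add: partial_def fun_eq_iff)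
  with Suc show ?case by simp
qed simp

lemma Ck_on_linear:
  assumes "bounded_linear L" "open S" "Ck_on m f S"
  shows "Ck_on m (\<lambda>x. L (f x)) S"
  using assms(3)
proof (induction m arbitrary: f)
  case 0
  then show ?case using assms(1) by (simp add: bounded_linear.continuous_on)
next
  case (Suc m)
  have d: "((\<lambda>x. L (f x)) has_derivative (\<lambda>h. L (frechet_derivative f (at x) h))) (at x)"
    if "x \<in> S" for x
    using Suc.prems that
    by (intro bounded_linear.has_derivative[OF assms(1)] frechet_derivative_works[THEN iffD1]) simp
  have "Ck_on m (partial i (\<lambda>x. L (f x))) S" for i
  proof (rule Ck_on_cong[OF assms(2)])
    show "Ck_on m (\<lambda>x. L (partial i f x)) S"
      using Suc.prems by (intro Suc.IH) simp
  qed (simp add: partial_eqI[OF d] flip: partial_def)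
  with d show ?case by (auto intro: differentiableI)
qed

lemma Ck_on_add:
  assumes "open S" "Ck_on m f S" "Ck_on m g S"
  shows "Ck_on m (\<lambda>x. f x + g x) S"
  using assms(2,3)
proof (induction m arbitrary: f g)
  case 0
  then show ?case by (simp add: continuous_on_add)
next
  case (Suc m)
  have d: "((\<lambda>x. f x + g x) has_derivative
      (\<lambda>h. frechet_derivative f (at x) h + frechet_derivative g (at x) h)) (at x)"
    if "x \<in> S" for x
    using Suc.prems that by (intro has_derivative_add frechet_derivative_works[THEN iffD1]) simp_all
  have "Ck_on m (partial i (\<lambda>x. f x + g x)) S" for i
  proof (rule Ck_on_cong[OF assms(1)])
    show "Ck_on m (\<lambda>x. partial i f x + partial i g x) S"
      using Suc.prems by (intro Suc.IH) simp_all
  qed (simp add: partial_eqI[OF d] flip: partial_def)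
  with d show ?case by (auto intro: differentiableI)
qed

lemma Ck_on_mult:
  fixes f g :: "real^'n::finite \<Rightarrow> 'k::real_normed_algebra"
  assumes "open S" "Ck_on m f S" "Ck_on m g S"
  shows "Ck_on m (\<lambda>x. f x * g x) S"
  using assms(2,3)
proof (induction m arbitrary: f g)
  case 0
  then show ?case by (simp add: continuous_on_mult)
next
  case (Suc m)
  have d: "((\<lambda>x. f x * g x) has_derivative
      (\<lambda>h. f x * frechet_derivative g (at x) h + frechet_derivative f (at x) h * g x)) (at x)"
    if "x \<in> S" for x
    using Suc.prems that by (intro has_derivative_mult frechet_derivative_works[THEN iffD1]) simp_all
  have "Ck_on m (partial i (\<lambda>x. f x * g x)) S" for i
  proof (rule Ck_on_cong[OF assms(1)])
    show "Ck_on m (\<lambda>x. f x * partial i g x + partial i f x * g x) S"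
      using Suc.prems Ck_on_SucD[OF Suc.prems(1)] Ck_on_SucD[OF Suc.prems(2)]
      by (intro Ck_on_add Suc.IH assms(1)) auto
  qed (simp add: partial_eqI[OF d] flip: partial_def)
  with d show ?case by (auto intro: differentiableI)
qed

lemma smooth_on_partial: "smooth_on S f \<Longrightarrow> smooth_on S (partial i f)"
  unfolding smooth_on_def by (metis Ck_on_Suc)

lemma smooth_on_differentiable: "smooth_on S f \<Longrightarrow> x \<in> S \<Longrightarrow> f differentiable (at x)"
  unfolding smooth_on_def by (metis Ck_on_Suc)

lemma smooth_on_continuous: "smooth_on S f \<Longrightarrow> continuous_on S f"
  unfolding smooth_on_def by (metis Ck_on.simps(1))

section \<open>Symmetry of second partial derivatives\<close>

lemma has_real_derivative_along_axis:
  fixes f :: "real^'n::finite \<Rightarrow> real"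
  assumes "f differentiable (at (y + s *\<^sub>R axis i 1))"
  shows "((\<lambda>r. f (y + r *\<^sub>R axis i 1)) has_real_derivative partial i f (y + s *\<^sub>R axis i 1)) (at s)"
proof -
  let ?x = "y + s *\<^sub>R axis i 1"
  let ?D = "frechet_derivative f (at ?x)"
  have D: "(f has_derivative ?D) (at ?x)"
    using assms by (simp add: frechet_derivative_works)
  have "((\<lambda>r. y + r *\<^sub>R axis i 1) has_derivative (\<lambda>r. r *\<^sub>R axis i 1)) (at s)"
    by (auto intro!: derivative_eq_intros)
  from has_derivative_compose[OF this D]
  have "((\<lambda>r. f (y + r *\<^sub>R axis i 1)) has_derivative (\<lambda>r. ?D (r *\<^sub>R axis i 1))) (at s)" .
  moreover have "?D (r *\<^sub>R axis i 1) = ?D (axis i 1) * r" for r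
    using linear_frechet_derivative[OF assms] by (simp add: linear_cmul)
  ultimately show ?thesis
    by (simp add: has_field_derivative_def partial_def)
qed

text \<open>The second difference over a square of side \<open>h\<close> is the increment along
  \<open>axis i 1\<close> of a first difference along \<open>axis j 1\<close>. The mean value
  theorem is applied once in direction \<open>i\<close> and, at the point found there, once more in
  direction \<open>j\<close>.\<close>

lemma second_difference_mvt:
  fixes f :: "real^'n::finite \<Rightarrow> real"
  assumes h: "0 < h"
    and S: "\<And>s r. 0 \<le> s \<Longrightarrow> s \<le> h \<Longrightarrow> 0 \<le> r \<Longrightarrow> r \<le> h \<Longrightarrow>
      x + s *\<^sub>R axis i 1 + r *\<^sub>R axis j 1 \<in> S"
    and f: "smooth_on S f"
  obtains s r where "0 < s" "s < h" "0 < r" "r < h"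
    "f (x + h *\<^sub>R axis i 1 + h *\<^sub>R axis j 1) - f (x + h *\<^sub>R axis i 1) - f (x + h *\<^sub>R axis j 1) + f x =
     h * h * partial j (partial i f) (x + s *\<^sub>R axis i 1 + r *\<^sub>R axis j 1)"
proof -
  let ?\<phi> = "\<lambda>s. f (x + h *\<^sub>R axis j 1 + s *\<^sub>R axis i 1) - f (x + s *\<^sub>R axis i 1)"
  have "\<exists>s. 0 < s \<and> s < h \<and> ?\<phi> h - ?\<phi> 0 = (h - 0) *
      (partial i f (x + h *\<^sub>R axis j 1 + s *\<^sub>R axis i 1) - partial i f (x + s *\<^sub>R axis i 1))"
  proof (rule MVT2[OF h])
    fix s assume s: "0 \<le> s" "s \<le> h"
    have "x + h *\<^sub>R axis j 1 + s *\<^sub>R axis i 1 \<in> S" "x + s *\<^sub>R axis i 1 \<in> S"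
      using S[of s h] S[of s 0] s h by (auto simp: algebra_simps)
    then show "(?\<phi> has_real_derivative
        partial i f (x + h *\<^sub>R axis j 1 + s *\<^sub>R axis i 1) - partial i f (x + s *\<^sub>R axis i 1)) (at s)"
      by (intro DERIV_diff has_real_derivative_along_axis smooth_on_differentiable[OF f])
  qed
  then obtain s where s: "0 < s" "s < h" and 1: "?\<phi> h - ?\<phi> 0 = h *
      (partial i f (x + h *\<^sub>R axis j 1 + s *\<^sub>R axis i 1) - partial i f (x + s *\<^sub>R axis i 1))"
    by auto
  let ?\<psi> = "\<lambda>r. partial i f (x + s *\<^sub>R axis i 1 + r *\<^sub>R axis j 1)"
  have "\<exists>r. 0 < r \<and> r < h \<and> ?\<psi> h - ?\<psi> 0 = (h - 0) *
      partial j (partial i f) (x + s *\<^sub>R axis i 1 + r *\<^sub>R axis j 1)"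
  proof (rule MVT2[OF h])
    fix r assume r: "0 \<le> r" "r \<le> h"
    show "(?\<psi> has_real_derivative
        partial j (partial i f) (x + s *\<^sub>R axis i 1 + r *\<^sub>R axis j 1)) (at r)"
      using S[of s r] s r
      by (intro has_real_derivative_along_axis smooth_on_differentiable[OF smooth_on_partial[OF f]]) auto
  qed
  then obtain r where r: "0 < r" "r < h" and 2: "?\<psi> h - ?\<psi> 0 =
      h * partial j (partial i f) (x + s *\<^sub>R axis i 1 + r *\<^sub>R axis j 1)"
    by auto
  have "?\<phi> h - ?\<phi> 0 = h * (?\<psi> h - ?\<psi> 0)"
    using 1 by (simp add: algebra_simps)
  then show ?thesis
    using that[OF s r] 2 by (simp add: algebra_simps)
qed

lemma isCont_near:
  fixes g :: "'a::metric_space \<Rightarrow> 'b::metric_space"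
  assumes "isCont g x" "0 < e"
  shows "\<exists>d>0. \<forall>y. dist y x < d \<longrightarrow> dist (g y) (g x) < e"
  using assms unfolding continuous_at_eps_delta by blast

text \<open>The second difference is symmetric in \<open>i\<close> and \<open>j\<close>, so the two
  mixed partials agree at two possibly different points of every small square at \<open>x\<close>.
  Continuity of both at \<open>x\<close> then leaves no room for a difference.\<close>

lemma mixed_partials_real:
  fixes f :: "real^'n::finite \<Rightarrow> real"
  assumes S: "open S" "x \<in> S" and f: "smooth_on S f"
  shows "partial j (partial i f) x = partial i (partial j f) x"
proof -
  let ?A = "partial j (partial i f)" and ?B = "partial i (partial j f)"
  have "\<bar>?A x - ?B x\<bar> \<le> 0 + e" if e: "e > 0" for e
  proof -
    have cont: "isCont (partial k (partial l f)) x" for k l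
      using smooth_on_continuous[OF smooth_on_partial[OF smooth_on_partial[OF f]]] S
      by (simp add: continuous_on_eq_continuous_at)
    obtain d1 where d1: "d1 > 0" and A: "\<forall>y. dist y x < d1 \<longrightarrow> dist (?A y) (?A x) < e / 2"
      using isCont_near[OF cont[of j i] half_gt_zero[OF e]] by (elim exE conjE)
    obtain d2 where d2: "d2 > 0" and B: "\<forall>y. dist y x < d2 \<longrightarrow> dist (?B y) (?B x) < e / 2"
      using isCont_near[OF cont[of i j] half_gt_zero[OF e]] by (elim exE conjE)
    obtain d3 where d3: "d3 > 0" "\<And>y. dist y x < d3 \<Longrightarrow> y \<in> S"
      using S unfolding open_dist by auto
    \<comment> \<open>Points of the square lie within \<open>2 * h\<close> of \<open>x\<close>; the
      divisor 3 makes this strictly less than each of the three radii.\<close>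
    define h where "h = min d1 (min d2 d3) / 3"
    have h: "h > 0" "2 * h < d1" "2 * h < d2" "2 * h < d3"
      using d1 d2 d3(1) by (auto simp: h_def)
    have near: "dist (x + s *\<^sub>R axis k 1 + r *\<^sub>R axis l 1) x \<le> 2 * h"
      if "0 \<le> s" "s \<le> h" "0 \<le> r" "r \<le> h" for s r and k l :: 'n
      using norm_triangle_ineq[of "s *\<^sub>R axis k (1::real)" "r *\<^sub>R axis l 1"] that
      by (simp add: dist_norm algebra_simps)
    have inS: "x + s *\<^sub>R axis k 1 + r *\<^sub>R axis l 1 \<in> S"
      if "0 \<le> s" "s \<le> h" "0 \<le> r" "r \<le> h" for s r and k l :: 'n
      using near[OF that, of k l] h(4) by (intro d3(2)) simp
    obtain s r where 1: "0 < s" "s < h" "0 < r" "r < h" and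
      A': "f (x + h *\<^sub>R axis i 1 + h *\<^sub>R axis j 1) - f (x + h *\<^sub>R axis i 1)
         - f (x + h *\<^sub>R axis j 1) + f x = h * h * ?A (x + s *\<^sub>R axis i 1 + r *\<^sub>R axis j 1)"
      by (rule second_difference_mvt[OF h(1) inS f, of i j])
    obtain s' r' where 2: "0 < s'" "s' < h" "0 < r'" "r' < h" and
      B': "f (x + h *\<^sub>R axis j 1 + h *\<^sub>R axis i 1) - f (x + h *\<^sub>R axis j 1)
         - f (x + h *\<^sub>R axis i 1) + f x = h * h * ?B (x + s' *\<^sub>R axis j 1 + r' *\<^sub>R axis i 1)"
      by (rule second_difference_mvt[OF h(1) inS f, of j i])
    have "h * h * ?A (x + s *\<^sub>R axis i 1 + r *\<^sub>R axis j 1) =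
        h * h * ?B (x + s' *\<^sub>R axis j 1 + r' *\<^sub>R axis i 1)"
      unfolding A'[symmetric] B'[symmetric] by (simp add: algebra_simps)
    then have "?A (x + s *\<^sub>R axis i 1 + r *\<^sub>R axis j 1) = ?B (x + s' *\<^sub>R axis j 1 + r' *\<^sub>R axis i 1)"
      using h(1) by simp
    moreover have "dist (?A (x + s *\<^sub>R axis i 1 + r *\<^sub>R axis j 1)) (?A x) < e / 2"
      using near[of s r i j] 1 h by (intro A[rule_format]) simp
    moreover have "dist (?B (x + s' *\<^sub>R axis j 1 + r' *\<^sub>R axis i 1)) (?B x) < e / 2"
      using near[of s' r' j i] 2 h by (intro B[rule_format]) simp
    ultimately show ?thesis
      unfolding dist_real_def by linarith
  qed
  then have "\<bar>?A x - ?B x\<bar> \<le> 0" by (rule field_le_epsilon)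
  then show ?thesis by simp
qed

lemma partial_linear:
  assumes "bounded_linear L" "f differentiable (at x)"
  shows "partial i (\<lambda>x. L (f x)) x = L (partial i f x)"
  using partial_eqI[OF bounded_linear.has_derivative[OF assms(1) frechet_derivative_works[THEN iffD1, OF assms(2)]]]
  by (simp add: partial_def)

lemma smooth_on_linear:
  "bounded_linear L \<Longrightarrow> open S \<Longrightarrow> smooth_on S f \<Longrightarrow> smooth_on S (\<lambda>x. L (f x))"
  by (simp add: smooth_on_def Ck_on_linear)

text \<open>The mean value theorem is a statement about real functions, so values in a Euclidean
  space are treated one coordinate at a time; coordinates commute with \<open>partial\<close> by
  linearity.\<close>

lemma mixed_partials:
  fixes f :: "real^'n::finite \<Rightarrow> 'k::euclidean_space"
  assumes S: "open S" "x \<in> S" and f: "smooth_on S f"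
  shows "partial j (partial i f) x = partial i (partial j f) x"
proof (rule euclidean_eqI)
  fix b :: 'k assume "b \<in> Basis"
  have L: "bounded_linear (\<lambda>v. v \<bullet> b)" by (rule bounded_linear_inner_left)
  have P: "partial k (partial l f) x \<bullet> b = partial k (partial l (\<lambda>y. f y \<bullet> b)) x" for k l
  proof -
    have "partial k (partial l f) x \<bullet> b = partial k (\<lambda>y. partial l f y \<bullet> b) x"
      using partial_linear[OF L smooth_on_differentiable[OF smooth_on_partial[OF f] S(2)]] by simp
    also have "\<dots> = partial k (partial l (\<lambda>y. f y \<bullet> b)) x"
      using S partial_linear[OF L smooth_on_differentiable[OF f]]
      by (intro partial_cong_open[OF S]) simp
    finally show ?thesis .
  qed
  show "partial j (partial i f) x \<bullet> b = partial i (partial j f) x \<bullet> b"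
    unfolding P by (rule mixed_partials_real[OF S smooth_on_linear[OF L S(1) f]])
qed

section \<open>Coordinate derivations on a ring of functions\<close>

text \<open>The common ground of \<open>smooth_base\<close> and \<open>formal_base\<close>.
  Restriction and gluing serve \<open>vector_bundle\<close>; sum, product and commutation rules are
  asked only for functions smooth on all of \<open>points B\<close>, since connections act on global
  sections. The sort of \<open>'K\<close> makes doubling injective, which separates the eigenspaces
  of \<open>J\<close>.\<close>

locale derivation_base =
  fixes B :: "('m, 'n::finite, 'K::{idom, semiring_char_0}) base"
  assumes open_points: "is_open B (points B)"
    and open_subset_points: "is_open B V \<Longrightarrow> V \<subseteq> points B"
    and smooth_cong: "is_open B V \<Longrightarrow> f \<in> smooth B V \<Longrightarrow> (\<And>p. p \<in> V \<Longrightarrow> f p = g p) \<Longrightarrow> g \<in> smooth B V"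
    and smooth_subset: "is_open B V \<Longrightarrow> is_open B W \<Longrightarrow> W \<subseteq> V \<Longrightarrow> f \<in> smooth B V \<Longrightarrow> f \<in> smooth B W"
    and smooth_local: "is_open B V \<Longrightarrow>
      (\<And>p. p \<in> V \<Longrightarrow> \<exists>W. is_open B W \<and> p \<in> W \<and> W \<subseteq> V \<and> f \<in> smooth B W) \<Longrightarrow> f \<in> smooth B V"
    and smooth_const: "is_open B V \<Longrightarrow> (\<lambda>p. c) \<in> smooth B V"
    and smooth_add: "is_open B V \<Longrightarrow> f \<in> smooth B V \<Longrightarrow> g \<in> smooth B V \<Longrightarrow> (\<lambda>p. f p + g p) \<in> smooth B V"
    and smooth_mult: "is_open B V \<Longrightarrow> f \<in> smooth B V \<Longrightarrow> g \<in> smooth B V \<Longrightarrow> (\<lambda>p. f p * g p) \<in> smooth B V"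
    and smooth_pderiv: "is_open B V \<Longrightarrow> f \<in> smooth B V \<Longrightarrow> pderiv_at B i f \<in> smooth B V"
    and pderiv_cong: "p \<in> points B \<Longrightarrow> (\<And>q. q \<in> points B \<Longrightarrow> f q = g q) \<Longrightarrow>
      pderiv_at B i f p = pderiv_at B i g p"
    and pderiv_const: "p \<in> points B \<Longrightarrow> pderiv_at B i (\<lambda>q. c) p = 0"
    and pderiv_add: "p \<in> points B \<Longrightarrow> f \<in> smooth B (points B) \<Longrightarrow> g \<in> smooth B (points B) \<Longrightarrow>
      pderiv_at B i (\<lambda>q. f q + g q) p = pderiv_at B i f p + pderiv_at B i g p"
    and pderiv_mult: "p \<in> points B \<Longrightarrow> f \<in> smooth B (points B) \<Longrightarrow> g \<in> smooth B (points B) \<Longrightarrow>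
      pderiv_at B i (\<lambda>q. f q * g q) p = f p * pderiv_at B i g p + pderiv_at B i f p * g p"
    and pderiv_commute: "p \<in> points B \<Longrightarrow> f \<in> smooth B (points B) \<Longrightarrow>
      pderiv_at B i (pderiv_at B j f) p = pderiv_at B j (pderiv_at B i f) p"

lemma derivation_base_smooth_base:
  fixes t :: "'m \<Rightarrow> real^'n::finite"
  assumes inj: "inj_on t T" and T: "open (t ` T)"
  shows "derivation_base (smooth_base T t :: ('m, 'n, 'k::{real_normed_field, euclidean_space}) base)"
proof
  let ?B = "smooth_base T t :: ('m, 'n, 'k) base"
  let ?inv = "the_inv_into T t"
  have inv: "?inv x \<in> V \<and> ?inv x \<in> T \<and> t (?inv x) = x" if "x \<in> t ` V" "V \<subseteq> T" for x V
    using that inj by (auto simp: the_inv_into_f_f subset_iff)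
  have invt: "?inv (t p) = p" if "p \<in> T" for p
    using that inj by (simp add: the_inv_into_f_f)
  have pd: "pderiv_at ?B i f = (\<lambda>p. partial i (f \<circ> ?inv) (t p))" for i f
    by (simp add: smooth_base_def partial_def)
  have sm: "f \<in> smooth ?B V \<longleftrightarrow> smooth_on (t ` V) (f \<circ> ?inv)" for f V
    by (simp add: smooth_base_def)
  have op: "is_open ?B V \<longleftrightarrow> V \<subseteq> T \<and> open (t ` V)" for V
    by (simp add: smooth_base_def)
  have pts: "points ?B = T" by (simp add: smooth_base_def)
  note [simp] = pd sm op pts
  show "is_open ?B (points ?B)" using T by simp
  fix V and f g :: "'m \<Rightarrow> 'k" and i j :: 'n and c :: 'k and p
  show "is_open ?B V \<Longrightarrow> V \<subseteq> points ?B" by simp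
  show "g \<in> smooth ?B V" if "is_open ?B V" "f \<in> smooth ?B V" "\<And>p. p \<in> V \<Longrightarrow> f p = g p"
    using that inv Ck_on_cong[of "t ` V" "f \<circ> ?inv" "g \<circ> ?inv"] by (simp add: smooth_on_def)
  show "f \<in> smooth ?B W" if "is_open ?B V" "is_open ?B W" "W \<subseteq> V" "f \<in> smooth ?B V" for W
    using that by (auto simp: smooth_on_def intro: Ck_on_subset)
  show "f \<in> smooth ?B V" if V: "is_open ?B V"
    and loc: "\<And>p. p \<in> V \<Longrightarrow> \<exists>W. is_open ?B W \<and> p \<in> W \<and> W \<subseteq> V \<and> f \<in> smooth ?B W"
  proof -
    have "Ck_on m (f \<circ> ?inv) (t ` V)" for m
    proof (rule Ck_on_local)
      show "open (t ` V)" using V by simp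
      fix x assume "x \<in> t ` V"
      then obtain p where p: "p \<in> V" "x = t p" by auto
      obtain W where "is_open ?B W" "p \<in> W" "W \<subseteq> V" "f \<in> smooth ?B W"
        using loc[OF p(1)] by blast
      then show "\<exists>S'. open S' \<and> x \<in> S' \<and> Ck_on m (f \<circ> ?inv) S'"
        using p by (intro exI[of _ "t ` W"]) (simp add: smooth_on_def)
    qed
    then show ?thesis by (simp add: smooth_on_def)
  qed
  show "(\<lambda>p. c) \<in> smooth ?B V" by (simp add: smooth_on_def o_def Ck_on_const)
  show "(\<lambda>p. f p + g p) \<in> smooth ?B V" if "is_open ?B V" "f \<in> smooth ?B V" "g \<in> smooth ?B V"
    using that by (simp add: smooth_on_def o_def Ck_on_add)
  show "(\<lambda>p. f p * g p) \<in> smooth ?B V" if "is_open ?B V" "f \<in> smooth ?B V" "g \<in> smooth ?B V"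
    using that by (simp add: smooth_on_def o_def Ck_on_mult)
  have pd_inv: "partial i (pderiv_at ?B j f \<circ> ?inv) x = partial i (partial j (f \<circ> ?inv)) x"
    if "x \<in> t ` T" for x i j
    using T that inv by (intro partial_cong_open[OF T]) auto
  show "pderiv_at ?B i f \<in> smooth ?B V" if V: "is_open ?B V" and f: "f \<in> smooth ?B V"
  proof -
    have "Ck_on m (pderiv_at ?B i f \<circ> ?inv) (t ` V)" for m
    proof (rule Ck_on_cong)
      show "Ck_on m (partial i (f \<circ> ?inv)) (t ` V)"
        using smooth_on_partial[of "t ` V" "f \<circ> ?inv" i] f by (simp add: smooth_on_def)
      show "partial i (f \<circ> ?inv) x = (pderiv_at ?B i f \<circ> ?inv) x" if "x \<in> t ` V" for x
        using inv[OF that] V by simp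
    qed (use V in simp)
    then show ?thesis by (simp add: smooth_on_def)
  qed
  assume p: "p \<in> points ?B"
  then have tp: "t p \<in> t ` T" by simp
  show "pderiv_at ?B i f p = pderiv_at ?B i g p" if "\<And>q. q \<in> points ?B \<Longrightarrow> f q = g q"
    using that inv[of _ T] unfolding pd by (intro partial_cong_open[OF T tp]) simp
  show "pderiv_at ?B i (\<lambda>q. c) p = 0"
    by (simp add: o_def partial_def)
  assume f: "f \<in> smooth ?B (points ?B)"
  have df: "((\<lambda>x. f (?inv x)) has_derivative frechet_derivative (\<lambda>x. f (?inv x)) (at (t p))) (at (t p))"
    using smooth_on_differentiable[OF _ tp] f by (intro frechet_derivative_works[THEN iffD1]) (simp add: o_def)
  show "pderiv_at ?B i (pderiv_at ?B j f) p = pderiv_at ?B j (pderiv_at ?B i f) p"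
    using mixed_partials[OF T tp, of "f \<circ> ?inv" i j] f pd_inv[OF tp] by (simp add: o_def)
  assume g: "g \<in> smooth ?B (points ?B)"
  have dg: "((\<lambda>x. g (?inv x)) has_derivative frechet_derivative (\<lambda>x. g (?inv x)) (at (t p))) (at (t p))"
    using smooth_on_differentiable[OF _ tp] g by (intro frechet_derivative_works[THEN iffD1]) (simp add: o_def)
  show "pderiv_at ?B i (\<lambda>q. f q + g q) p = pderiv_at ?B i f p + pderiv_at ?B i g p"
    using partial_eqI[OF has_derivative_add[OF df dg], of i] by (simp add: o_def partial_def)
  show "pderiv_at ?B i (\<lambda>q. f q * g q) p = f p * pderiv_at ?B i g p + pderiv_at ?B i f p * g p"
    using partial_eqI[OF has_derivative_mult[OF df dg], of i] invt p by (simp add: o_def partial_def)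
qed

context derivation_base
begin

lemma smooth_sum:
  "is_open B V \<Longrightarrow> (\<And>i. i \<in> I \<Longrightarrow> f i \<in> smooth B V) \<Longrightarrow> (\<lambda>p. \<Sum>i\<in>I. f i p) \<in> smooth B V"
  by (induction I rule: infinite_finite_induct) (auto intro: smooth_const smooth_add)

lemma pderiv_sum:
  assumes "p \<in> points B" "\<And>k. k \<in> I \<Longrightarrow> f k \<in> smooth B (points B)"
  shows "pderiv_at B i (\<lambda>q. \<Sum>k\<in>I. f k q) p = (\<Sum>k\<in>I. pderiv_at B i (f k) p)"
  using assms(2)
proof (induction I rule: infinite_finite_induct)
  case (insert k I)
  then show ?case
    using pderiv_add[OF assms(1), of "f k" "\<lambda>q. \<Sum>k\<in>I. f k q"] open_points
    by (simp add: smooth_sum)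
qed (simp_all add: pderiv_const assms(1))

lemma smooth_uminus: "is_open B V \<Longrightarrow> f \<in> smooth B V \<Longrightarrow> (\<lambda>p. - f p) \<in> smooth B V"
  using smooth_mult[of V "\<lambda>p. - 1" f] smooth_const[of V "- 1"] by simp

lemma pderiv_uminus:
  "p \<in> points B \<Longrightarrow> f \<in> smooth B (points B) \<Longrightarrow> pderiv_at B i (\<lambda>q. - f q) p = - pderiv_at B i f p"
  using pderiv_mult[of p "\<lambda>p. - 1" f i] smooth_const[OF open_points, of "- 1"]
  by (simp add: pderiv_const)

lemma smooth_act:
  "is_open B V \<Longrightarrow> X \<in> vfields B V \<Longrightarrow> f \<in> smooth B V \<Longrightarrow> act B X f \<in> smooth B V"
  unfolding act_def[abs_def] vfields_def
  by (intro smooth_sum smooth_mult smooth_pderiv) auto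

lemma act_cong:
  "p \<in> points B \<Longrightarrow> (\<And>q. q \<in> points B \<Longrightarrow> f q = g q) \<Longrightarrow> act B X f p = act B X g p"
  unfolding act_def by (intro sum.cong refl arg_cong2[where f = "(*)"] pderiv_cong)

lemma act_add:
  "p \<in> points B \<Longrightarrow> f \<in> smooth B (points B) \<Longrightarrow> g \<in> smooth B (points B) \<Longrightarrow>
    act B X (\<lambda>q. f q + g q) p = act B X f p + act B X g p"
  by (simp add: act_def pderiv_add sum.distrib algebra_simps)

lemma act_uminus:
  "p \<in> points B \<Longrightarrow> f \<in> smooth B (points B) \<Longrightarrow> act B X (\<lambda>q. - f q) p = - act B X f p"
  by (simp add: act_def pderiv_uminus sum_negf)

lemma act_sum:
  "p \<in> points B \<Longrightarrow> (\<And>k. k \<in> I \<Longrightarrow> f k \<in> smooth B (points B)) \<Longrightarrow>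
    act B X (\<lambda>q. \<Sum>k\<in>I. f k q) p = (\<Sum>k\<in>I. act B X (f k) p)"
  by (simp add: act_def pderiv_sum sum_distrib_left) (rule sum.swap)

lemma act_mult:
  "p \<in> points B \<Longrightarrow> f \<in> smooth B (points B) \<Longrightarrow> g \<in> smooth B (points B) \<Longrightarrow>
    act B X (\<lambda>q. f q * g q) p = act B X f p * g p + f p * act B X g p"
  by (simp add: act_def pderiv_mult sum.distrib sum_distrib_left sum_distrib_right algebra_simps)

text \<open>In \<open>X (Y f)\<close> the second-order terms are symmetric in \<open>X\<close> and
  \<open>Y\<close> because coordinate derivations commute, so they cancel in the commutator. The
  first-order terms left over are those of the bracket.\<close>

lemma act_lie_bracket:
  assumes p: "p \<in> points B" and X: "X \<in> vfields B (points B)" and Y: "Y \<in> vfields B (points B)"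
    and f: "f \<in> smooth B (points B)"
  shows "act B (lie_bracket B X Y) f p = act B X (act B Y f) p - act B Y (act B X f) p"
proof -
  have expand: "act B X (act B Y f) p = (\<Sum>j\<in>UNIV. act B X (\<lambda>q. Y q $ j) p * pderiv_at B j f p) +
      (\<Sum>j\<in>UNIV. \<Sum>i\<in>UNIV. Y p $ j * X p $ i * pderiv_at B i (pderiv_at B j f) p)"
    if "X \<in> vfields B (points B)" "Y \<in> vfields B (points B)" for X Y
  proof -
    have "act B X (act B Y f) p = (\<Sum>j\<in>UNIV. act B X (\<lambda>q. Y q $ j * pderiv_at B j f q) p)"
      unfolding act_def[of B Y f, abs_def] using that f p
      by (intro act_sum) (auto simp: vfields_def intro!: smooth_mult smooth_pderiv open_points)
    also have "\<dots> = (\<Sum>j\<in>UNIV. act B X (\<lambda>q. Y q $ j) p * pderiv_at B j f p +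
        Y p $ j * act B X (pderiv_at B j f) p)"
      using that f p by (intro sum.cong refl act_mult)
        (auto simp: vfields_def intro!: smooth_pderiv open_points)
    also have "\<dots> = (\<Sum>j\<in>UNIV. act B X (\<lambda>q. Y q $ j) p * pderiv_at B j f p) +
        (\<Sum>j\<in>UNIV. \<Sum>i\<in>UNIV. Y p $ j * X p $ i * pderiv_at B i (pderiv_at B j f) p)"
      by (simp add: sum.distrib act_def[of B X "pderiv_at B _ f"] sum_distrib_left mult.assoc)
    finally show ?thesis .
  qed
  have "(\<Sum>j\<in>UNIV. \<Sum>i\<in>UNIV. Y p $ j * X p $ i * pderiv_at B i (pderiv_at B j f) p) =
      (\<Sum>j\<in>UNIV. \<Sum>i\<in>UNIV. X p $ j * Y p $ i * pderiv_at B i (pderiv_at B j f) p)"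
    by (subst sum.swap) (simp add: mult_ac pderiv_commute[OF p f])
  then show ?thesis
    unfolding expand[OF X Y] expand[OF Y X]
    by (simp add: act_def[of B "lie_bracket B X Y"] lie_bracket_def left_diff_distrib sum_subtractf)
qed

end

text \<open>Every axiom is checked coefficient by coefficient in \<open>u\<close>. A coefficient of
  a product is a finite convolution, so closure under products and the Leibniz rule reduce to finite
  sums of products of smooth functions.\<close>

lemma derivation_base_formal_base:
  fixes t :: "'m \<Rightarrow> real^'n::finite"
  assumes inj: "inj_on t T" and T: "open (t ` T)"
  shows "derivation_base
    (formal_base T t :: ('m, 'n, 'k::{real_normed_field, euclidean_space} fps) base)"
proof -
  let ?B = "formal_base T t :: ('m, 'n, 'k fps) base"
  let ?S = "smooth_base T t :: ('m, 'n, 'k) base"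
  interpret S: derivation_base ?S
    by (rule derivation_base_smooth_base[OF inj T])
  have pd: "pderiv_at ?B i f p = Abs_fps (\<lambda>m. pderiv_at ?S i (\<lambda>q. fps_nth (f q) m) p)" for i f p
    by (simp add: formal_base_def)
  have sm: "f \<in> smooth ?B V \<longleftrightarrow> (\<forall>m. (\<lambda>p. fps_nth (f p) m) \<in> smooth ?S V)" for f V
    by (simp add: formal_base_def)
  have op: "is_open ?B = is_open ?S"
    by (simp add: formal_base_def smooth_base_def)
  have pts: "points ?B = points ?S"
    by (simp add: formal_base_def smooth_base_def)
  show ?thesis
  proof (unfold_locales, unfold op pts)
    show "is_open ?S (points ?S)" by (rule S.open_points)
    fix V and f g :: "'m \<Rightarrow> 'k fps" and i j :: 'n and c :: "'k fps" and p
    show "is_open ?S V \<Longrightarrow> V \<subseteq> points ?S" by (rule S.open_subset_points)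
    show "g \<in> smooth ?B V" if "is_open ?S V" "f \<in> smooth ?B V" "\<And>p. p \<in> V \<Longrightarrow> f p = g p"
      unfolding sm
    proof
      fix m
      have "(\<lambda>p. fps_nth (f p) m) \<in> smooth ?S V" using that(2) sm by blast
      then show "(\<lambda>p. fps_nth (g p) m) \<in> smooth ?S V"
        by (rule S.smooth_cong[OF that(1)]) (simp add: that(3))
    qed
    show "f \<in> smooth ?B W" if "is_open ?S V" "is_open ?S W" "W \<subseteq> V" "f \<in> smooth ?B V" for W
      using that S.smooth_subset unfolding sm by blast
    show "f \<in> smooth ?B V" if "is_open ?S V"
      and loc: "\<And>p. p \<in> V \<Longrightarrow> \<exists>W. is_open ?S W \<and> p \<in> W \<and> W \<subseteq> V \<and> f \<in> smooth ?B W"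
      unfolding sm
    proof
      fix m
      show "(\<lambda>p. fps_nth (f p) m) \<in> smooth ?S V"
        using loc unfolding sm by (intro S.smooth_local[OF that(1)]) blast
    qed
    show "(\<lambda>p. c) \<in> smooth ?B V" if "is_open ?S V"
      using that by (simp add: sm S.smooth_const)
    show "(\<lambda>p. f p + g p) \<in> smooth ?B V" if "is_open ?S V" "f \<in> smooth ?B V" "g \<in> smooth ?B V"
      using that by (simp add: sm S.smooth_add)
    show "(\<lambda>p. f p * g p) \<in> smooth ?B V" if "is_open ?S V" "f \<in> smooth ?B V" "g \<in> smooth ?B V"
      using that by (simp add: sm fps_mult_nth S.smooth_sum S.smooth_mult)
    show "pderiv_at ?B i f \<in> smooth ?B V" if "is_open ?S V" "f \<in> smooth ?B V"
      using that by (simp add: sm pd S.smooth_pderiv)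
    assume p: "p \<in> points ?S"
    show "pderiv_at ?B i f p = pderiv_at ?B i g p" if "\<And>q. q \<in> points ?S \<Longrightarrow> f q = g q"
      unfolding pd by (intro fps_ext) (simp add: that cong: S.pderiv_cong[OF p])
    show "pderiv_at ?B i (\<lambda>q. c) p = 0"
      by (intro fps_ext) (simp add: pd S.pderiv_const[OF p])
    assume f: "f \<in> smooth ?B (points ?S)"
    show "pderiv_at ?B i (pderiv_at ?B j f) p = pderiv_at ?B j (pderiv_at ?B i f) p"
      using f by (intro fps_ext) (simp add: pd sm S.pderiv_commute[OF p, of _ i j])
    assume g: "g \<in> smooth ?B (points ?S)"
    show "pderiv_at ?B i (\<lambda>q. f q + g q) p = pderiv_at ?B i f p + pderiv_at ?B i g p"
      using f g by (intro fps_ext) (simp add: pd sm S.pderiv_add[OF p])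
    show "pderiv_at ?B i (\<lambda>q. f q * g q) p = f p * pderiv_at ?B i g p + pderiv_at ?B i f p * g p"
      using f g by (intro fps_ext) (simp add: pd sm fps_mult_nth S.pderiv_sum[OF p] S.smooth_mult
          S.pderiv_mult[OF p] S.open_points sum.distrib)
  qed
qed

text \<open>Turns existence and uniqueness of coordinates into \<open>is_basis\<close>. The natural
  index set here is a finite type, which \<open>h\<close> merely enumerates. Since
  \<open>dependent\<close> concerns sets of vectors, injectivity of the family has to be known
  before a relation on the set can be read as one between indices.\<close>

lemma is_basisI:
  fixes sc :: "'K::comm_ring_1 \<Rightarrow> 'e::ab_group_add \<Rightarrow> 'e" and b :: "'i::finite \<Rightarrow> 'e"
  assumes "module sc" and sub: "module.subspace sc S" and b: "\<And>k. b k \<in> S"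
    and gen: "\<And>v. v \<in> S \<Longrightarrow> \<exists>c. v = (\<Sum>k\<in>UNIV. sc (c k) (b k))"
    and indep: "\<And>c k. (\<Sum>k\<in>UNIV. sc (c k) (b k)) = 0 \<Longrightarrow> c k = 0"
    and h: "bij_betw h {..<r} (UNIV :: 'i set)"
  shows "is_basis sc S r (b \<circ> h)"
proof -
  interpret module sc by fact
  have image: "(b \<circ> h) ` {..<r} = range b"
    using h by (simp add: bij_betw_def flip: image_image image_comp)
  have "inj b"
  proof (rule injI, rule ccontr)
    fix k l assume "b k = b l" "k \<noteq> l"
    \<comment> \<open>Coincident vectors would satisfy the relation with coefficient 1 at
      \<open>k\<close> and -1 at \<open>l\<close>, against \<open>indep\<close>.\<close>
    have "(\<Sum>m\<in>UNIV. sc ((if m = k then 1 else 0) - (if m = l then 1 else 0)) (b m)) =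
        (\<Sum>m\<in>UNIV. (if m = k then b m else 0) - (if m = l then b m else 0))"
      by (intro sum.cong) auto
    also have "\<dots> = 0"
      using \<open>b k = b l\<close> by (simp add: sum_subtractf)
    finally show False
      using indep[of "\<lambda>m. (if m = k then 1 else 0) - (if m = l then 1 else 0)" k] \<open>k \<noteq> l\<close> by simp
  qed
  moreover have "inj_on h {..<r}"
    using h by (simp add: bij_betw_def)
  moreover have "\<not> dependent (range b)"
  proof
    assume "dependent (range b)"
    then obtain u v where uv: "v \<in> range b" "u v \<noteq> 0" "(\<Sum>v\<in>range b. sc (u v) v) = 0"
      by (auto simp: dependent_finite)
    have "(\<Sum>k\<in>UNIV. sc (u (b k)) (b k)) = 0"
      using uv(3) \<open>inj b\<close> by (simp add: sum.reindex)
    then show False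
      using indep[of "\<lambda>k. u (b k)"] uv by auto
  qed
  moreover have "span (range b) = S"
  proof
    show "span (range b) \<subseteq> S" using b sub by (intro span_minimal) auto
    show "S \<subseteq> span (range b)"
    proof
      fix v assume "v \<in> S"
      from gen[OF this] obtain c where "v = (\<Sum>k\<in>UNIV. sc (c k) (b k))" ..
      then show "v \<in> span (range b)"
        by (simp add: span_sum span_scale span_base)
    qed
  qed
  ultimately show ?thesis
    unfolding is_basis_def image by (auto intro: comp_inj_on inj_on_subset)
qed

section \<open>Bundles of vectors and covectors\<close>

lemma direct_sum_tangent_cotangent [simp]:
  "scale (direct_sum (tangent_bundle B) (cotangent_bundle B)) c v = (c *s fst v, c *s snd v)"
  "fibre (direct_sum (tangent_bundle B) (cotangent_bundle B)) p = UNIV"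
  "sections (direct_sum (tangent_bundle B) (cotangent_bundle B)) V =
    {s. fst \<circ> s \<in> vfields B V \<and> snd \<circ> s \<in> vfields B V}"
  by (simp_all add: direct_sum_def tangent_bundle_def cotangent_bundle_def case_prod_beta)

lemma frame_coeffs_axis: "frame_coeffs (\<lambda>i. axis i 1) v = v"
  unfolding frame_coeffs_def by (simp add: basis_expansion)

text \<open>The standard frame of \<open>H\<close>: \<open>Inl i\<close> stands for
  \<open>\<partial>/\<partial>t\<^sup>i\<close> and \<open>Inr i\<close> for
  \<open>dt\<^sup>i\<close>. Indexing by a sum type avoids splitting a range of naturals in two
  halves.\<close>

abbreviation sum_axis :: "'n + 'n \<Rightarrow> ('K::comm_ring_1^'n::finite) \<times> ('K^'n)" where
  "sum_axis k \<equiv> case_sum (\<lambda>i. (axis i 1, 0)) (\<lambda>i. (0, axis i 1)) k"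

lemma sum_axis_expansion:
  "(\<Sum>k\<in>UNIV. (c k *s fst (sum_axis k), c k *s snd (sum_axis k))) =
    ((\<chi> i. c (Inl i)), (\<chi> i. c (Inr i)))"
  by (simp add: sum.Plus flip: UNIV_Plus_UNIV)
     (simp add: o_def prod_eq_iff fst_sum snd_sum vec_eq_iff axis_def if_distrib cong: if_cong)

context derivation_base
begin

text \<open>Coefficients in the standard frame are the components. The frame is prescribed on
  \<open>points B\<close> only, which is all that is known of the dual coframe;
  \<open>act_cong\<close> shows that the derivative does not see the rest.\<close>

lemma parallel_frame_connection_axis:
  assumes "\<And>q i. q \<in> points B \<Longrightarrow> e i q = axis i 1" and p: "p \<in> points B"
  shows "parallel_frame_connection B e X s p = (\<chi> i. act B X (\<lambda>q. s q $ i) p)"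
proof -
  have "act B X (\<lambda>q. frame_coeffs (\<lambda>j. e j q) (s q) $ i) p = act B X (\<lambda>q. s q $ i) p" for i
    by (rule act_cong[OF p]) (simp add: assms(1) frame_coeffs_axis)
  then show ?thesis
    using basis_expansion[of "\<chi> i. act B X (\<lambda>q. s q $ i) p"]
    by (simp add: parallel_frame_connection_def assms)
qed

lemma vfields_cong:
  "is_open B V \<Longrightarrow> X \<in> vfields B V \<Longrightarrow> (\<And>p. p \<in> V \<Longrightarrow> X p = Y p) \<Longrightarrow> Y \<in> vfields B V"
  unfolding vfields_def using smooth_cong[of V "\<lambda>p. X p $ _" "\<lambda>p. Y p $ _"] by auto

lemma vfields_subset:
  "is_open B V \<Longrightarrow> is_open B W \<Longrightarrow> W \<subseteq> V \<Longrightarrow> X \<in> vfields B V \<Longrightarrow> X \<in> vfields B W"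
  unfolding vfields_def using smooth_subset by auto

lemma vfields_local:
  assumes "is_open B V"
    and "\<And>p. p \<in> V \<Longrightarrow> \<exists>W. is_open B W \<and> p \<in> W \<and> W \<subseteq> V \<and> X \<in> vfields B W"
  shows "X \<in> vfields B V"
proof -
  have "(\<lambda>p. X p $ i) \<in> smooth B V" for i
    using assms(2) unfolding vfields_def by (intro smooth_local[OF assms(1)]) blast
  then show ?thesis by (simp add: vfields_def)
qed

lemma local_frame_direct_sum:
  assumes h: "bij_betw h {..<r} (UNIV :: ('n + 'n) set)" and V: "is_open B V"
  shows "local_frame B (direct_sum (tangent_bundle B) (cotangent_bundle B)) V r
    (\<lambda>i q. sum_axis (h i))"
  unfolding local_frame_def
proof (intro conjI ballI allI impI)
  let ?E = "direct_sum (tangent_bundle B) (cotangent_bundle B)"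
  fix q
  have "module (scale ?E)"
    by unfold_locales (simp_all add: vec.scale_right_distrib vec.scale_left_distrib)
  then have "is_basis (scale ?E) UNIV r (sum_axis \<circ> h)"
  proof (rule is_basisI)
    show "module.subspace (scale ?E) UNIV"
      by (rule module.subspace_UNIV) fact
    show "\<exists>c. v = (\<Sum>k\<in>UNIV. scale ?E (c k) (sum_axis k))" for v
      by (intro exI[of _ "case_sum (($) (fst v)) (($) (snd v))"]) (simp add: sum_axis_expansion)
    show "c k = 0" if "(\<Sum>k\<in>UNIV. scale ?E (c k) (sum_axis k)) = 0" for c k
      using that by (cases k) (auto simp: sum_axis_expansion zero_prod_def vec_eq_iff)
  qed (simp_all add: h)
  then show "is_basis (scale ?E) (fibre ?E q) r (\<lambda>i. sum_axis (h i))"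
    by (simp add: o_def)
next
  let ?E = "direct_sum (tangent_bundle B) (cotangent_bundle B)"
  fix W s assume W: "is_open B W \<and> W \<subseteq> V"
  have sum_h: "(\<Sum>i<r. scale ?E (a (h i)) (sum_axis (h i))) =
      ((\<chi> i. a (Inl i)), (\<chi> i. a (Inr i)))" for a
    using sum.reindex_bij_betw[OF h, of "\<lambda>k. scale ?E (a k) (sum_axis k)"]
    by (simp add: sum_axis_expansion)
  show "s \<in> sections ?E W \<longleftrightarrow> (\<exists>a. (\<forall>i<r. a i \<in> smooth B W) \<and>
      (\<forall>q\<in>W. s q = (\<Sum>i<r. scale ?E (a i q) (sum_axis (h i)))))"
  proof
    assume s: "s \<in> sections ?E W"
    let ?a = "\<lambda>k q. case_sum (($) (fst (s q))) (($) (snd (s q))) k"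
    have "?a k \<in> smooth B W" for k
      using s by (cases k) (auto simp: vfields_def)
    moreover have "s q = (\<Sum>i<r. scale ?E (?a (h i) q) (sum_axis (h i)))" for q
      unfolding sum_h by simp
    ultimately show "\<exists>a. (\<forall>i<r. a i \<in> smooth B W) \<and>
        (\<forall>q\<in>W. s q = (\<Sum>i<r. scale ?E (a i q) (sum_axis (h i))))"
      by (intro exI[of _ "\<lambda>i. ?a (h i)"]) simp
  next
    assume "\<exists>a. (\<forall>i<r. a i \<in> smooth B W) \<and>
        (\<forall>q\<in>W. s q = (\<Sum>i<r. scale ?E (a i q) (sum_axis (h i))))"
    then obtain a where a: "\<And>i. i < r \<Longrightarrow> a i \<in> smooth B W"
      and s: "\<And>q. q \<in> W \<Longrightarrow> s q = (\<Sum>i<r. scale ?E (a i q) (sum_axis (h i)))"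
      by blast
    \<comment> \<open>The section equals the combination of frame vectors only on \<open>W\<close>,
      so smoothness of its components is obtained by congruence on \<open>W\<close>.\<close>
    have "(\<lambda>q. fst (s q) $ j) \<in> smooth B W" for j
    proof (rule smooth_cong)
      show "(\<lambda>q. \<Sum>i<r. a i q * fst (sum_axis (h i)) $ j) \<in> smooth B W"
        using W a by (intro smooth_sum smooth_mult smooth_const) auto
    qed (use W s in \<open>simp_all add: fst_sum\<close>)
    moreover have "(\<lambda>q. snd (s q) $ j) \<in> smooth B W" for j
    proof (rule smooth_cong)
      show "(\<lambda>q. \<Sum>i<r. a i q * snd (sum_axis (h i)) $ j) \<in> smooth B W"
        using W a by (intro smooth_sum smooth_mult smooth_const) auto
    qed (use W s in \<open>simp_all add: snd_sum\<close>)
    ultimately show "s \<in> sections ?E W"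
      by (simp add: vfields_def)
  qed
qed

text \<open>The standard frame is global, so \<open>points B\<close> itself can serve as
  trivialising neighbourhood of each point.\<close>

lemma vector_bundle_direct_sum:
  "vector_bundle B (direct_sum (tangent_bundle B) (cotangent_bundle B))"
proof -
  let ?E = "direct_sum (tangent_bundle B) (cotangent_bundle B)"
  have mod: "module (scale ?E)"
    by unfold_locales (simp_all add: vec.scale_right_distrib vec.scale_left_distrib)
  obtain h where h: "bij_betw h {..<card (UNIV :: ('n + 'n) set)} (UNIV :: ('n + 'n) set)"
    using ex_bij_betw_nat_finite[of "UNIV :: ('n + 'n) set"] by (auto simp: lessThan_atLeast0)
  have "s \<in> sections ?E V" if V: "is_open B V"
    and loc: "\<forall>p\<in>V. \<exists>W. is_open B W \<and> p \<in> W \<and> W \<subseteq> V \<and> s \<in> sections ?E W" for V s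
  proof -
    have "fst \<circ> s \<in> vfields B V" "snd \<circ> s \<in> vfields B V"
      by (rule vfields_local[OF V], use loc in auto)+
    then show ?thesis by simp
  qed
  moreover have "sections ?E V \<subseteq> sections ?E W"
    if "is_open B V" "is_open B W" "W \<subseteq> V" for V W
    using vfields_subset[OF that] by auto
  ultimately show ?thesis
    using mod module.subspace_UNIV[OF mod] open_points local_frame_direct_sum[OF h]
    unfolding vector_bundle_def by (simp del: direct_sum_tangent_cotangent(1,3)) blast
qed

end

section \<open>The para-Kaehler structure\<close>

text \<open>The evaluation pairing of covectors with vectors in components. It is bilinear over
  \<open>'K\<close>, without conjugation in the complex case.\<close>

definition dot :: "'K::comm_ring_1^'n::finite \<Rightarrow> 'K^'n \<Rightarrow> 'K" where
  "dot a b = (\<Sum>i\<in>UNIV. a $ i * b $ i)"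

lemma dot_simps:
  "dot (a + b) c = dot a c + dot b c" "dot a (b + c) = dot a b + dot a c"
  "dot (x *s a) c = x * dot a c" "dot a (x *s c) = x * dot a c"
  "dot (- a) c = - dot a c" "dot a (- c) = - dot a c"
  "dot 0 c = 0" "dot a 0 = 0"
  by (simp_all add: dot_def sum.distrib algebra_simps sum_negf sum_distrib_left)

lemma dot_commute: "dot a b = dot b a"
  by (simp add: dot_def mult.commute)

lemma dot_axis: "dot a (axis i 1) = a $ i"
  by (simp add: dot_def axis_def if_distrib cong: if_cong)

context derivation_base
begin

lemma smooth_diff:
  "is_open B V \<Longrightarrow> f \<in> smooth B V \<Longrightarrow> g \<in> smooth B V \<Longrightarrow> (\<lambda>p. f p - g p) \<in> smooth B V"
  using smooth_add[of V f "\<lambda>p. - g p"] smooth_uminus[of V g] by simp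

lemma act_diff:
  "p \<in> points B \<Longrightarrow> f \<in> smooth B (points B) \<Longrightarrow> g \<in> smooth B (points B) \<Longrightarrow>
    act B X (\<lambda>q. f q - g q) p = act B X f p - act B X g p"
  using act_add[of p f "\<lambda>q. - g q"] smooth_uminus[OF open_points] by (simp add: act_uminus)

text \<open>The shape that \<open>nabla_plus\<close> and \<open>nabla_minus\<close> both take at
  \<open>points B\<close> once the dual coframe is the coordinate coframe.\<close>

definition covd :: "('m, 'n, 'K, 'K^'n) covd" where
  "covd X s p = (\<chi> i. act B X (\<lambda>q. s q $ i) p)"

lemma smooth_dot:
  "is_open B V \<Longrightarrow> a \<in> vfields B V \<Longrightarrow> b \<in> vfields B V \<Longrightarrow> (\<lambda>p. dot (a p) (b p)) \<in> smooth B V"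
  unfolding dot_def by (intro smooth_sum smooth_mult) (auto simp: vfields_def)

lemma vfields_uminus: "is_open B V \<Longrightarrow> X \<in> vfields B V \<Longrightarrow> (\<lambda>p. - X p) \<in> vfields B V"
  by (auto simp: vfields_def intro: smooth_uminus)

lemma covd_vfields:
  "X \<in> vfields B (points B) \<Longrightarrow> s \<in> vfields B (points B) \<Longrightarrow> covd X s \<in> vfields B (points B)"
  unfolding vfields_def by (simp add: covd_def) (auto intro!: smooth_act open_points simp: vfields_def)

lemma covd_cong:
  "p \<in> points B \<Longrightarrow> (\<And>q. q \<in> points B \<Longrightarrow> s q = s' q) \<Longrightarrow> covd X s p = covd X s' p"
  by (simp add: covd_def vec_eq_iff) (blast intro: act_cong)

lemma covd_field_add: "covd (\<lambda>q. X q + Y q) s p = covd X s p + covd Y s p"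
  by (simp add: covd_def act_def vec_eq_iff sum.distrib algebra_simps)

lemma covd_field_scale: "covd (\<lambda>q. f q *s X q) s p = f p *s covd X s p"
  by (simp add: covd_def act_def vec_eq_iff sum_distrib_left algebra_simps)

lemma covd_add:
  "p \<in> points B \<Longrightarrow> s \<in> vfields B (points B) \<Longrightarrow> s' \<in> vfields B (points B) \<Longrightarrow>
    covd X (\<lambda>q. s q + s' q) p = covd X s p + covd X s' p"
  by (simp add: covd_def vec_eq_iff vfields_def act_add)

lemma covd_uminus:
  "p \<in> points B \<Longrightarrow> s \<in> vfields B (points B) \<Longrightarrow> covd X (\<lambda>q. - s q) p = - covd X s p"
  by (simp add: covd_def vec_eq_iff vfields_def act_uminus)

lemma covd_scale:
  "p \<in> points B \<Longrightarrow> f \<in> smooth B (points B) \<Longrightarrow> s \<in> vfields B (points B) \<Longrightarrow>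
    covd X (\<lambda>q. f q *s s q) p = act B X f p *s s p + f p *s covd X s p"
  by (simp add: covd_def vec_eq_iff vfields_def act_mult)

lemma covd_flat:
  assumes "p \<in> points B" "X \<in> vfields B (points B)" "Y \<in> vfields B (points B)" "s \<in> vfields B (points B)"
  shows "covd X (covd Y s) p - covd Y (covd X s) p - covd (lie_bracket B X Y) s p = 0"
  using assms act_lie_bracket[OF assms(1-3)] by (simp add: covd_def vec_eq_iff vfields_def)

text \<open>Duality of the two connections under the evaluation pairing; the parallelism of the
  symplectic form is this identity applied to both of its terms.\<close>

lemma act_dot:
  assumes "p \<in> points B" "a \<in> vfields B (points B)" "b \<in> vfields B (points B)"
  shows "act B X (\<lambda>q. dot (a q) (b q)) p = dot (covd X a p) (b p) + dot (a p) (covd X b p)"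
  using assms unfolding dot_def
  by (subst act_sum) (auto simp: vfields_def covd_def act_mult sum.distrib intro!: smooth_mult open_points)

text \<open>The potential reaches the associated structure only through the dual coframe. With that
  fixed by \<open>coframe\<close>, what remains is the constant structure on pairs, with form
  \<open>\<beta>(X) - \<alpha>(Y)\<close> and componentwise derivatives.\<close>

lemma para_kaehler_legendre_bundle:
  assumes coframe: "\<And>p i. p \<in> points B \<Longrightarrow> dual_coframe B F i p = axis i 1"
  shows "para_kaehler_bundle B (associated_pk (legendre_bundle B F))"
proof -
  let ?P = "associated_pk (legendre_bundle B F)"
  let ?T = "points B"
  let ?E = "direct_sum (tangent_bundle B) (cotangent_bundle B)"
  let ?D = "pk_conn ?P"
  have E: "pk_bundle ?P = ?E" by (simp add: associated_pk_def legendre_bundle_def)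
  have J: "pk_J ?P p v = (fst v, - snd v)" for p v
    by (simp add: associated_pk_def case_prod_beta)
  have w: "pk_omega ?P p v v' = dot (snd v') (fst v) - dot (snd v) (fst v')" for p v v'
    by (simp add: associated_pk_def legendre_bundle_def case_prod_beta dot_def sum_negf)
  have D: "?D X s p = (covd X (fst \<circ> s) p, covd X (snd \<circ> s) p)" if "p \<in> ?T" for X s p
    using that coframe
    by (simp add: associated_pk_def legendre_bundle_def affine_connection_def covd_def
        parallel_frame_connection_axis)
  have sec: "s \<in> sections ?E ?T \<longleftrightarrow> fst \<circ> s \<in> vfields B ?T \<and> snd \<circ> s \<in> vfields B ?T" for s
    by simp
  have mod: "module (scale ?E)"
    by unfold_locales (simp_all add: vec.scale_right_distrib vec.scale_left_distrib)
  \<comment> \<open>An eigenvector of \<open>J\<close> has one component equal to its own negative.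
    That this component vanishes means \<open>2 * x = 0\<close> implies \<open>x = 0\<close>, which
    holds in a domain of characteristic zero without dividing by 2.\<close>
  have neg_iff: "- a = a \<longleftrightarrow> a = 0" for a :: "'K^'n"
  proof
    assume "- a = a"
    have "a $ i = 0" for i
    proof -
      have "- (a $ i) = a $ i" by (subst vector_uminus_component[symmetric], subst \<open>- a = a\<close>) (rule refl)
      then have "a $ i + a $ i = 0" by (metis add.right_inverse)
      then show ?thesis by (simp flip: mult_2)
    qed
    then show "a = 0" by (simp add: vec_eq_iff)
  qed simp
  have eq_neg_iff: "a = - a \<longleftrightarrow> a = 0" for a :: "'K^'n"
    by (subst eq_commute) (rule neg_iff)
  have endo: "bundle_endomorphism B ?E (pk_J ?P)"
    using vfields_uminus[OF open_points]
    by (auto simp: bundle_endomorphism_def J vec_eq_iff o_def)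
  have JJ: "pk_J ?P p (pk_J ?P p v) = v" for p v
    by (simp add: J)
  have rank: "\<exists>r b b'. is_basis (scale ?E) {v \<in> fibre ?E p. pk_J ?P p v = v} r b \<and>
      is_basis (scale ?E) {v \<in> fibre ?E p. pk_J ?P p v = - v} r b'" for p
  proof -
    obtain h where h: "bij_betw h {..<card (UNIV :: 'n set)} (UNIV :: 'n set)"
      using ex_bij_betw_nat_finite[of "UNIV :: 'n set"] by (auto simp: lessThan_atLeast0)
    have plus: "{v \<in> fibre ?E p. pk_J ?P p v = v} = UNIV \<times> {0}"
      by (auto simp: J neg_iff)
    have minus: "{v \<in> fibre ?E p. pk_J ?P p v = - v} = {0} \<times> UNIV"
      by (auto simp: J prod_eq_iff eq_neg_iff)
    have sums: "(\<Sum>i\<in>UNIV. scale ?E (c i) (axis i 1, 0)) = ((\<chi> i. c i), 0)"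
      "(\<Sum>i\<in>UNIV. scale ?E (c i) (0, axis i 1)) = (0, (\<chi> i. c i))" for c
      using basis_expansion[of "\<chi> i. c i"] by (simp_all add: prod_eq_iff fst_sum snd_sum)
    have "is_basis (scale ?E) (UNIV \<times> {0}) (card (UNIV :: 'n set)) ((\<lambda>i. (axis i 1, 0)) \<circ> h)"
    proof (rule is_basisI[OF mod _ _ _ _ h])
      show "\<exists>c. v = (\<Sum>i\<in>UNIV. scale ?E (c i) (axis i 1, 0))" if "v \<in> UNIV \<times> {0}" for v
        using that by (intro exI[of _ "($) (fst v)"]) (auto simp: sums simp del: direct_sum_tangent_cotangent)
      show "c k = 0" if "(\<Sum>i\<in>UNIV. scale ?E (c i) (axis i 1, 0)) = 0" for c k
        using that unfolding sums by (simp add: zero_prod_def vec_eq_iff)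
    qed (auto simp: module.subspace_def[OF mod] zero_prod_def)
    moreover
    have "is_basis (scale ?E) ({0} \<times> UNIV) (card (UNIV :: 'n set)) ((\<lambda>i. (0, axis i 1)) \<circ> h)"
    proof (rule is_basisI[OF mod _ _ _ _ h])
      show "\<exists>c. v = (\<Sum>i\<in>UNIV. scale ?E (c i) (0, axis i 1))" if "v \<in> {0} \<times> UNIV" for v
        using that by (intro exI[of _ "($) (snd v)"]) (auto simp: sums simp del: direct_sum_tangent_cotangent)
      show "c k = 0" if "(\<Sum>i\<in>UNIV. scale ?E (c i) (0, axis i 1)) = 0" for c k
        using that unfolding sums by (simp add: zero_prod_def vec_eq_iff)
    qed (auto simp: module.subspace_def[OF mod] zero_prod_def)
    ultimately show ?thesis unfolding plus minus by blast
  qed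
  have bil: "bilinear_form B ?E (pk_omega ?P)"
  proof -
    have "(\<lambda>p. dot (snd (s' p)) (fst (s p)) - dot (snd (s p)) (fst (s' p))) \<in> smooth B ?T"
      if "s \<in> sections ?E ?T" "s' \<in> sections ?E ?T" for s s'
      using that by (intro smooth_diff smooth_dot open_points) (auto simp: o_def)
    then show ?thesis
      by (simp add: bilinear_form_def linear_functional_def w dot_simps algebra_simps)
  qed
  have nondeg: "nondegenerate B ?E (pk_omega ?P)"
    unfolding nondegenerate_def
  proof (intro ballI allI impI)
    fix p f assume "linear_functional ?E p f"
    then have add: "f (v + v') = f v + f v'" and sc: "f (c *s fst v, c *s snd v) = c * f v"
      for c v v' by (simp_all add: linear_functional_def del: split_paired_All)
    have f0: "f 0 = 0" using add[of 0 0] by simp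
    have fsum: "f (\<Sum>i\<in>I. g i) = (\<Sum>i\<in>I. f (g i))" for g and I :: "'n set"
      by (induction I rule: infinite_finite_induct) (simp_all add: f0 add)
    have expand: "f v = dot (fst v) (\<chi> i. f (axis i 1, 0)) + dot (snd v) (\<chi> i. f (0, axis i 1))" for v
    proof -
      \<comment> \<open>The zero components stay multiples of 0, so that each summand has literally
        the form that \<open>sc\<close> rewrites.\<close>
      let ?a = "\<Sum>i\<in>UNIV. (fst v $ i *s axis i 1, fst v $ i *s 0)"
      let ?b = "\<Sum>i\<in>UNIV. (snd v $ i *s 0, snd v $ i *s axis i 1)"
      have "v = ?a + ?b"
        by (simp add: prod_eq_iff fst_sum snd_sum basis_expansion)
      then have "f v = f (?a + ?b)" by (rule arg_cong)
      also have "\<dots> = f ?a + f ?b" by (rule add)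
      also have "\<dots> = (\<Sum>i\<in>UNIV. fst v $ i * f (axis i 1, 0)) + (\<Sum>i\<in>UNIV. snd v $ i * f (0, axis i 1))"
        unfolding fsum using sc[of _ "(axis _ 1, 0)"] sc[of _ "(0, axis _ 1)"]
        by (simp del: vec.scale_zero_right)
      finally show ?thesis by (simp add: dot_def)
    qed
    \<comment> \<open>The witness is forced: pairing \<open>v\<close> with
      \<open>(0, axis i 1)\<close> gives the component \<open>i\<close> of its first part, and
      pairing it with \<open>(axis i 1, 0)\<close> gives minus that of its second part.\<close>
    let ?v = "((\<chi> i. f (0, axis i 1)), - (\<chi> i. f (axis i 1, 0)))"
    have "v = ?v" if "\<forall>v'\<in>fibre ?E p. pk_omega ?P p v v' = f v'" for v
    proof -
      have v: "dot (snd v') (fst v) - dot (snd v) (fst v') = f v'" for v'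
        using that by (simp add: w)
      have "fst v $ i = f (0, axis i 1)" "snd v $ i = - f (axis i 1, 0)" for i
        using v[of "(0, axis i 1)"] v[of "(axis i 1, 0)", symmetric]
        by (simp_all add: dot_simps dot_axis dot_commute[of "axis i 1"])
      then show ?thesis by (simp add: prod_eq_iff vec_eq_iff)
    qed
    moreover have "pk_omega ?P p ?v v' = f v'" for v'
      unfolding w expand[of v'] by (simp add: dot_simps dot_commute)
    ultimately show "\<exists>!v. v \<in> fibre ?E p \<and> (\<forall>v'\<in>fibre ?E p. pk_omega ?P p v v' = f v')"
      by (intro ex1I[of _ ?v]) auto
  qed
  have D_sec: "?D X s \<in> sections ?E ?T" if "X \<in> vfields B ?T" "s \<in> sections ?E ?T" for X s
  proof -
    have "fst \<circ> ?D X s \<in> vfields B ?T"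
      by (rule vfields_cong[OF open_points covd_vfields[of X "fst \<circ> s"]]) (use that in \<open>simp_all add: D\<close>)
    moreover have "snd \<circ> ?D X s \<in> vfields B ?T"
      by (rule vfields_cong[OF open_points covd_vfields[of X "snd \<circ> s"]]) (use that in \<open>simp_all add: D\<close>)
    ultimately show ?thesis by simp
  qed
  have conn: "is_connection B ?E ?D"
  proof -
    have "?D X (\<lambda>q. s q + s' q) p = ?D X s p + ?D X s' p"
      if "s \<in> sections ?E ?T" "s' \<in> sections ?E ?T" "p \<in> ?T" for X s s' p
      using that covd_add[OF that(3), of "fst \<circ> s" "fst \<circ> s'"] covd_add[OF that(3), of "snd \<circ> s" "snd \<circ> s'"]
      by (simp add: D o_def)
    moreover have "?D X (\<lambda>q. scale ?E (f q) (s q)) p =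
        scale ?E (act B X f p) (s p) + scale ?E (f p) (?D X s p)"
      if "f \<in> smooth B ?T" "s \<in> sections ?E ?T" "p \<in> ?T" for X f s p
      using that covd_scale[OF that(3,1), of "fst \<circ> s"] covd_scale[OF that(3,1), of "snd \<circ> s"]
      by (simp add: D o_def)
    ultimately show ?thesis
      using D_sec by (simp add: is_connection_def D covd_field_add covd_field_scale
          del: direct_sum_tangent_cotangent(3))
  qed
  have flat: "flat_connection B ?E ?D"
    unfolding flat_connection_def
  proof (intro ballI)
    fix X Y s p assume XY: "X \<in> vfields B ?T" "Y \<in> vfields B ?T" and s: "s \<in> sections ?E ?T" and p: "p \<in> ?T"
    \<comment> \<open>The inner derivative agrees with \<open>covd\<close> at
      \<open>points B\<close> only, so it is replaced under the outer one by congruence.\<close>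
    have DD: "?D X (?D Y s) p = (covd X (covd Y (fst \<circ> s)) p, covd X (covd Y (snd \<circ> s)) p)" for X Y
      unfolding D[OF p] by (intro arg_cong2[where f = Pair] covd_cong[OF p]) (simp_all add: D)
    show "?D X (?D Y s) p - ?D Y (?D X s) p - ?D (lie_bracket B X Y) s p = 0"
      unfolding DD unfolding D[OF p] using covd_flat[OF p XY] s by (simp add: zero_prod_def)
  qed
  have DJ: "?D X (\<lambda>q. pk_J ?P q (s q)) p = pk_J ?P p (?D X s p)"
    if "s \<in> sections ?E ?T" "p \<in> ?T" for X s p
    using that covd_uminus[OF that(2), of "snd \<circ> s"] by (simp add: D J o_def)
  have Dw: "act B X (\<lambda>q. pk_omega ?P q (s q) (s' q)) p =
      pk_omega ?P p (?D X s p) (s' p) + pk_omega ?P p (s p) (?D X s' p)"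
    if "s \<in> sections ?E ?T" "s' \<in> sections ?E ?T" "p \<in> ?T" for X s s' p
  proof -
    have vf: "(\<lambda>q. fst (s q)) \<in> vfields B ?T" "(\<lambda>q. snd (s q)) \<in> vfields B ?T"
      "(\<lambda>q. fst (s' q)) \<in> vfields B ?T" "(\<lambda>q. snd (s' q)) \<in> vfields B ?T"
      using that by (simp_all add: o_def)
    have "act B X (\<lambda>q. pk_omega ?P q (s q) (s' q)) p =
        act B X (\<lambda>q. dot (snd (s' q)) (fst (s q))) p - act B X (\<lambda>q. dot (snd (s q)) (fst (s' q))) p"
      unfolding w using vf that(3) by (intro act_diff smooth_dot open_points)
    also have "\<dots> = pk_omega ?P p (?D X s p) (s' p) + pk_omega ?P p (s p) (?D X s' p)"
      using vf that(3) by (simp add: act_dot D w o_def)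
    finally show ?thesis .
  qed
  show ?thesis
    unfolding para_kaehler_bundle_def Let_def E
    using vector_bundle_direct_sum endo JJ rank bil nondeg conn flat DJ Dw
    by (simp add: w J dot_simps del: direct_sum_tangent_cotangent)
qed

end

section \<open>The dual coframe\<close>

lemma invertible_transpose:
  fixes A :: "'K::comm_semiring_1^'n^'n"
  assumes "invertible A"
  shows "invertible (transpose A)"
  using assms unfolding invertible_def by (metis matrix_transpose_mul transpose_mat)

text \<open>A ring homomorphism carries a two-sided inverse to a two-sided inverse. The
  homomorphisms meant are extension of scalars on power series and the constant term.\<close>

lemma invertible_map_matrix:
  fixes h :: "'a::comm_ring_1 \<Rightarrow> 'b::comm_ring_1" and A :: "'a^'n::finite^'n"
  assumes h: "h 0 = 0" "h 1 = 1" "\<And>x y. h (x + y) = h x + h y" "\<And>x y. h (x * y) = h x * h y"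
    and "invertible A"
  shows "invertible (\<chi> i j. h (A $ i $ j))"
proof -
  have sum: "h (\<Sum>i\<in>I. f i) = (\<Sum>i\<in>I. h (f i))" for f and I :: "'n set"
    by (induction I rule: infinite_finite_induct) (simp_all add: h)
  have mult: "(\<chi> i j. h (X $ i $ j)) ** (\<chi> i j. h (Y $ i $ j)) = mat 1"
    if "X ** Y = mat 1" for X Y :: "'a^'n^'n"
  proof -
    have "(\<Sum>k\<in>UNIV. h (X $ i $ k) * h (Y $ k $ j)) = h ((X ** Y) $ i $ j)" for i j
      by (simp add: matrix_matrix_mult_def sum h)
    then show ?thesis
      unfolding that by (simp add: matrix_matrix_mult_def mat_def vec_eq_iff h)
  qed
  obtain A' where "A ** A' = mat 1" "A' ** A = mat 1"
    using \<open>invertible A\<close> unfolding invertible_def by blast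
  then show ?thesis
    unfolding invertible_def using mult by blast
qed

text \<open>The Jacobian of \<open>eta\<close> is the transpose of \<open>hessian\<close>. Pairing
  column \<open>i\<close> of its inverse with the basis vector \<open>j\<close> sums over the first
  index of \<open>hessian\<close>, and this is the entry \<open>(j, i)\<close> of the Jacobian times
  its inverse.\<close>

lemma dual_coframe_eq_axis:
  assumes "invertible (hessian B F p)"
  shows "dual_coframe B F i p = axis i 1"
proof -
  define M where "M = (\<chi> j k. pderiv_at B k (eta B F j) p)"
  have M: "M = transpose (hessian B F p)"
    by (simp add: M_def hessian_def eta_def transpose_def vec_eq_iff)
  have "invertible M"
    unfolding M by (rule invertible_transpose[OF assms])
  then have "\<exists>A'. M ** A' = mat 1 \<and> A' ** M = mat 1"
    by (simp add: invertible_def)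
  then have inv: "M ** matrix_inv M = mat 1"
    unfolding matrix_inv_def by (rule someI2_ex) simp
  have "dual_coframe B F i p $ j = axis i 1 $ j" for j
  proof -
    have "dual_coframe B F i p $ j = (\<Sum>a\<in>UNIV. hessian B F p $ a $ j * matrix_inv M $ a $ i)"
      by (simp add: dual_coframe_def hessian_metric_def d_eta_def column_def axis_def if_distrib
          M_def cong: if_cong)
    also have "\<dots> = (M ** matrix_inv M) $ j $ i"
      by (simp add: matrix_matrix_mult_def M transpose_def)
    finally show ?thesis
      unfolding inv by (auto simp: mat_def axis_def)
  qed
  then show ?thesis by (simp add: vec_eq_iff)
qed

section \<open>Invertibility of the Hessian over formal power series\<close>

lemma sum_axis_mult: "(\<Sum>j\<in>UNIV. axis a 1 $ j * f j) = (f a :: 'K::comm_ring_1)"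
  by (simp add: axis_def if_distrib[of "\<lambda>x. x * _"] cong: if_cong)

text \<open>\<open>P\<close> and \<open>Q\<close> are the Jacobians at \<open>p\<close> of the local
  coordinates \<theta> and \<eta>. Their invertibility is part of \<open>affine_coordinates\<close>,
  and the expression of \<open>g\<close> through them is the last requirement on the local
  potentials.\<close>

lemma dually_flat_factorization:
  fixes B :: "('m, 'n::finite, real fps) base"
  assumes "dually_flat B g Dp Dm" and p: "p \<in> points B"
  shows "\<exists>P Q :: real fps^'n^'n. invertible P \<and> invertible Q \<and>
    (\<forall>v w. g p v w = (\<Sum>i\<in>UNIV. (\<Sum>j\<in>UNIV. v $ j * P $ i $ j) * (\<Sum>j\<in>UNIV. w $ j * Q $ i $ j)))"
proof -
  note potentials = assms(1)[unfolded dually_flat_def, THEN conjunct2, THEN conjunct2, THEN conjunct2,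
      THEN bspec, OF p]
  from potentials show ?thesis
  proof (elim exE conjE)
    fix V \<theta> \<eta> \<Psi> \<Psi>s
    assume V: "p \<in> V"
      and coords: "affine_coordinates B V Dp \<theta>" "affine_coordinates B V Dm \<eta>"
      and potential: "\<forall>q\<in>V. (\<forall>j. pderiv_at B j \<Psi> q = (\<Sum>i\<in>UNIV. \<eta> i q * pderiv_at B j (\<theta> i) q)) \<and>
              \<Psi> q + \<Psi>s q = (\<Sum>i\<in>UNIV. \<theta> i q * \<eta> i q) \<and>
              (\<forall>v w. g q v w =
                 (\<Sum>i\<in>UNIV. (\<Sum>j\<in>UNIV. v $ j * pderiv_at B j (\<theta> i) q) *
                            (\<Sum>j\<in>UNIV. w $ j * pderiv_at B j (\<eta> i) q)))"
    show ?thesis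
      using coords V potential
      by (intro exI[of _ "\<chi> i j. pderiv_at B j (\<theta> i) p"] exI[of _ "\<chi> i j. pderiv_at B j (\<eta> i) p"])
        (simp add: affine_coordinates_def)
  qed
qed

text \<open>The local potentials factor the Hessian as \<open>P\<^sup>T Q\<close> with \<open>P\<close>, \<open>Q\<close> the Jacobians of the
  affine coordinates, so it is invertible over the ring of formal power series itself.\<close>

lemma hessian_qft_invertible:
  fixes t :: "'m \<Rightarrow> real^'n::finite"
  assumes "hessian_qft T t F" and p: "p \<in> T"
  shows "invertible (hessian (formal_base T t) F p)"
proof -
  let ?B = "formal_base T t :: ('m, 'n, real fps) base"
  let ?H = "hessian ?B F p"
  from assms(1) obtain Dm where Dm: "dually_flat ?B (hessian_metric ?B F) (affine_connection ?B) Dm"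
    unfolding hessian_qft_def by (elim exE conjE)
  have pB: "p \<in> points ?B"
    using p by (simp add: formal_base_def)
  obtain P Q :: "real fps^'n^'n" where inv: "invertible P" "invertible Q"
    and g: "\<forall>v w. hessian_metric ?B F p v w =
      (\<Sum>i\<in>UNIV. (\<Sum>j\<in>UNIV. v $ j * P $ i $ j) * (\<Sum>j\<in>UNIV. w $ j * Q $ i $ j))"
    using dually_flat_factorization[OF Dm pB] by (elim exE conjE)
  \<comment> \<open>Entries of the Hessian are values of its bilinear form at pairs of standard
    basis vectors; there the factorization collapses to a single sum over \<open>i\<close>.\<close>
  have "?H $ a $ b = (transpose P ** Q) $ a $ b" for a b
  proof -
    have "?H $ a $ b = (\<Sum>i\<in>UNIV. axis a 1 $ i * (\<Sum>j\<in>UNIV. axis b 1 $ j * ?H $ i $ j))"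
      by (simp add: sum_axis_mult)
    also have "\<dots> = hessian_metric ?B F p (axis a 1) (axis b 1)"
      by (simp add: hessian_metric_def sum_distrib_left mult_ac)
    also have "\<dots> = (transpose P ** Q) $ a $ b"
      unfolding g[rule_format]
      by (simp add: sum_axis_mult matrix_matrix_mult_def transpose_def)
    finally show ?thesis .
  qed
  then have "?H = transpose P ** Q"
    by (simp add: vec_eq_iff)
  then show ?thesis
    using invertible_mult[OF invertible_transpose[OF inv(1)] inv(2)] by simp
qed

section \<open>Extension of scalars from the reals to \<open>'k\<close>\<close>

lemma pderiv_of_real:
  fixes f :: "'m \<Rightarrow> real" and t :: "'m \<Rightarrow> real^'n::finite"
  assumes "inj_on t T" "open (t ` T)" "f \<in> smooth (smooth_base T t) T" "p \<in> T"
  shows "pderiv_at (smooth_base T t) i (\<lambda>q. of_real (f q) :: 'k::{real_normed_field, euclidean_space}) p =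
    of_real (pderiv_at (smooth_base T t) i f p)"
proof -
  have "f \<circ> the_inv_into T t differentiable (at (t p))"
    using assms by (intro smooth_on_differentiable[of "t ` T"]) (simp_all add: smooth_base_def)
  from partial_linear[OF bounded_linear_of_real this, of i]
  show ?thesis by (simp add: smooth_base_def partial_def o_def)
qed

text \<open>\<open>of_real\<close> is pulled out of one derivative at a time. After the inner step
  the equality is known on \<open>T\<close> only, so the outer derivative needs congruence before it
  can be treated the same way.\<close>

lemma hessian_of_real:
  fixes f :: "'m \<Rightarrow> real" and t :: "'m \<Rightarrow> real^'n::finite"
  assumes T: "inj_on t T" "open (t ` T)" and f: "f \<in> smooth (smooth_base T t) T" and p: "p \<in> T"
  shows "hessian (smooth_base T t) (\<lambda>q. of_real (f q) :: 'k::{real_normed_field, euclidean_space}) p $ i $ j =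
    of_real (hessian (smooth_base T t) f p $ i $ j)"
proof -
  interpret R: derivation_base "smooth_base T t :: ('m, 'n, real) base"
    by (rule derivation_base_smooth_base[OF T])
  interpret K: derivation_base "smooth_base T t :: ('m, 'n, 'k) base"
    by (rule derivation_base_smooth_base[OF T])
  have pts: "points (smooth_base T t :: ('m, 'n, 'k) base) = T"
    by (simp add: smooth_base_def)
  have op: "is_open (smooth_base T t :: ('m, 'n, real) base) T"
    using T by (simp add: smooth_base_def)
  have "pderiv_at (smooth_base T t) i (pderiv_at (smooth_base T t) j (\<lambda>q. of_real (f q) :: 'k)) p =
      pderiv_at (smooth_base T t) i (\<lambda>q. of_real (pderiv_at (smooth_base T t) j f q)) p"
    using p pderiv_of_real[OF T f] by (intro K.pderiv_cong) (simp_all add: pts)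
  also have "\<dots> = of_real (pderiv_at (smooth_base T t) i (pderiv_at (smooth_base T t) j f) p)"
    by (intro pderiv_of_real[OF T] R.smooth_pderiv op f p)
  finally show ?thesis by (simp add: hessian_def)
qed

lemma hessian_formal_base:
  "fps_nth (hessian (formal_base T t) F p $ i $ j) m =
    hessian (smooth_base T t) (\<lambda>q. fps_nth (F q) m) p $ i $ j"
  by (simp add: hessian_def formal_base_def)

section \<open>Restriction to the tree level\<close>

lemma at_0_scale: "at_0 (c *s v) = fps_nth c 0 *s at_0 v"
  by (simp add: at_0_def vec_eq_iff)

lemma at_0_add: "at_0 (v + w) = at_0 v + at_0 w"
  by (simp add: at_0_def vec_eq_iff)

text \<open>A series without constant term is \<open>fps_X\<close> times its shift. Hence the kernel
  of the reduction is exactly the multiples of \<open>u\<close>, as the quotient by \<open>u\<close>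
  requires.\<close>

lemma at_0_eq_0_iff:
  fixes v :: "'k::comm_ring_1 fps^'n::finite"
  shows "at_0 v = 0 \<longleftrightarrow> (\<exists>w. v = fps_X *s w)"
proof
  assume "at_0 v = 0"
  then have "v $ i = fps_X * fps_shift 1 (v $ i)" for i
    by (auto simp: at_0_def vec_eq_iff intro!: fps_ext)
  then have "v = fps_X *s (\<chi> i. fps_shift 1 (v $ i))"
    by (simp add: vec_eq_iff)
  then show "\<exists>w. v = fps_X *s w" ..
qed (auto simp: at_0_def vec_eq_iff)

text \<open>Lifts from \<open>u = 0\<close> are series constant in \<open>u\<close>: this gives
  surjectivity on fibres and, since the higher coefficients are zero functions, also on smooth
  sections.\<close>

lemma restricts_at_0_tangent_bundle:
  fixes t :: "'m \<Rightarrow> real^'n::finite"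
  assumes T: "inj_on t T" "open (t ` T)"
  shows "restricts_at_0 (formal_base T t :: ('m, 'n, 'k::{real_normed_field, euclidean_space} fps) base)
    at_0 (tangent_bundle (formal_base T t)) (tangent_bundle (smooth_base T t))"
proof -
  let ?B = "formal_base T t :: ('m, 'n, 'k fps) base" and ?S = "smooth_base T t :: ('m, 'n, 'k) base"
  interpret S: derivation_base ?S by (rule derivation_base_smooth_base[OF T])
  have op: "is_open ?B = is_open ?S" by (simp add: formal_base_def smooth_base_def)
  have sm: "f \<in> smooth ?B V \<longleftrightarrow> (\<forall>m. (\<lambda>p. fps_nth (f p) m) \<in> smooth ?S V)" for f V
    by (simp add: formal_base_def)
  have surj: "at_0 (\<chi> i. fps_const (v $ i)) = v" for v :: "'k^'n"
    by (simp add: at_0_def)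
  have "at_0 \<circ> s \<in> vfields ?S V" if "s \<in> vfields ?B V" for s V
    using that by (simp add: vfields_def at_0_def sm)
  moreover have "\<exists>s\<in>vfields ?B V. \<forall>p\<in>V. at_0 (s p) = s0 p"
    if V: "is_open ?S V" and s0: "s0 \<in> vfields ?S V" for s0 V
  proof
    have "(\<lambda>p. fps_nth (fps_const (s0 p $ i)) m) \<in> smooth ?S V" for i m
      using s0 S.smooth_const[OF V, of 0] by (cases m) (simp_all add: vfields_def)
    then show "(\<lambda>p. \<chi> i. fps_const (s0 p $ i)) \<in> vfields ?B V"
      by (simp add: vfields_def sm)
  qed (simp add: surj)
  moreover have "range (at_0 :: 'k fps^'n \<Rightarrow> _) = UNIV"
    using surj by (metis surjI)
  ultimately show ?thesis
    by (simp add: restricts_at_0_def tangent_bundle_def op at_0_add at_0_scale at_0_eq_0_iff)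
qed

lemma restricts_at_0_direct_sum:
  assumes "restricts_at_0 B r E E0" "restricts_at_0 B r' E' E0'"
  shows "restricts_at_0 B (map_prod r r') (direct_sum E E') (direct_sum E0 E0')"
  unfolding restricts_at_0_def
proof (intro conjI ballI allI impI)
  note R = assms[unfolded restricts_at_0_def, THEN conjunct1, THEN bspec]
  note S = assms[unfolded restricts_at_0_def, THEN conjunct2, rule_format]
  {
    fix p assume p: "p \<in> points B"
    note Rp = R(1)[OF p] R(2)[OF p]
    show "map_prod r r' ` fibre (direct_sum E E') p = fibre (direct_sum E0 E0') p"
      using Rp by (simp add: direct_sum_def map_prod_surj_on)
    fix v assume "v \<in> fibre (direct_sum E E') p"
    then obtain a b where v: "v = (a, b)" "a \<in> fibre E p" "b \<in> fibre E' p"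
      by (auto simp: direct_sum_def)
    show "map_prod r r' (v + w) = map_prod r r' v + map_prod r r' w"
      if "w \<in> fibre (direct_sum E E') p" for w
      using that Rp v by (cases w) (simp add: direct_sum_def)
    show "map_prod r r' (scale (direct_sum E E') c v) =
        scale (direct_sum E0 E0') (fps_nth c 0) (map_prod r r' v)" for c
      using Rp v by (simp add: direct_sum_def)
    have "r a = 0 \<longleftrightarrow> (\<exists>w\<in>fibre E p. a = scale E fps_X w)"
      "r' b = 0 \<longleftrightarrow> (\<exists>w\<in>fibre E' p. b = scale E' fps_X w)"
      using Rp v by blast+
    then show "map_prod r r' v = 0 \<longleftrightarrow>
        (\<exists>w\<in>fibre (direct_sum E E') p. v = scale (direct_sum E E') fps_X w)"
      by (auto simp: direct_sum_def v zero_prod_def)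
  next
    fix V assume V: "is_open B V"
    have comp: "fst \<circ> (map_prod r r' \<circ> s) = r \<circ> (fst \<circ> s)"
      "snd \<circ> (map_prod r r' \<circ> s) = r' \<circ> (snd \<circ> s)" for s
      by auto
    show "map_prod r r' \<circ> s \<in> sections (direct_sum E0 E0') V"
      if "s \<in> sections (direct_sum E E') V" for s
      using that conjunct1[OF S(1)[OF V]] conjunct1[OF S(2)[OF V]]
      unfolding direct_sum_def by (simp add: comp)
    fix s0 assume "s0 \<in> sections (direct_sum E0 E0') V"
    then have s0: "fst \<circ> s0 \<in> sections E0 V" "snd \<circ> s0 \<in> sections E0' V"
      by (simp_all add: direct_sum_def)
    obtain s where s: "s \<in> sections E V" "\<forall>p\<in>V. r (s p) = (fst \<circ> s0) p"
      using conjunct2[OF S(1)[OF V], rule_format, OF s0(1)] by blast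
    obtain s' where s': "s' \<in> sections E' V" "\<forall>p\<in>V. r' (s' p) = (snd \<circ> s0) p"
      using conjunct2[OF S(2)[OF V], rule_format, OF s0(2)] by blast
    show "\<exists>s\<in>sections (direct_sum E E') V. \<forall>p\<in>V. map_prod r r' (s p) = s0 p"
      using s s' by (intro bexI[of _ "\<lambda>p. (s p, s' p)"]) (simp_all add: direct_sum_def o_def)
  }
qed

text \<open>The constant term of a product is the product of constant terms, and the derivations act
  coefficientwise, so the equality is one of expressions and asks nothing of \<open>X\<close>,
  \<open>s\<close> or \<open>p\<close>.\<close>

lemma covd_at_0:
  fixes t :: "'m \<Rightarrow> real^'n::finite"
    and s :: "'m \<Rightarrow> 'k::{real_normed_field, euclidean_space} fps^'n"
  assumes T: "inj_on t T" "open (t ` T)"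
  shows "at_0 (derivation_base.covd (formal_base T t) X s p) =
    derivation_base.covd (smooth_base T t) (at_0 \<circ> X) (at_0 \<circ> s) p"
  unfolding derivation_base.covd_def[OF derivation_base_formal_base[OF T]]
    derivation_base.covd_def[OF derivation_base_smooth_base[OF T]]
  by (simp add: at_0_def act_def fps_sum_nth formal_base_def)

lemma legendre_restricts_at_0_legendre_bundle:
  fixes t :: "'m \<Rightarrow> real^'n::finite"
    and G :: "'m \<Rightarrow> 'k::{real_normed_field, euclidean_space} fps"
  assumes T: "inj_on t T" "open (t ` T)"
    and coframe: "\<And>p i. p \<in> T \<Longrightarrow> dual_coframe (formal_base T t) G i p = axis i 1"
    and coframe0: "\<And>p i. p \<in> T \<Longrightarrow> dual_coframe (smooth_base T t) (\<lambda>p. fps_nth (G p) 0) i p = axis i 1"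
  shows "legendre_restricts_at_0 (formal_base T t) (legendre_bundle (formal_base T t) G)
    (legendre_bundle (smooth_base T t) (\<lambda>p. fps_nth (G p) 0))"
proof -
  let ?B = "formal_base T t :: ('m, 'n, 'k fps) base" and ?S = "smooth_base T t :: ('m, 'n, 'k) base"
  interpret B: derivation_base ?B by (rule derivation_base_formal_base[OF T])
  interpret S: derivation_base ?S by (rule derivation_base_smooth_base[OF T])
  have pts: "points ?B = T" "points ?S = T"
    by (simp_all add: formal_base_def smooth_base_def)
  \<comment> \<open>Both frames are coordinate frames on \<open>T\<close>, so both connections
    become \<open>covd\<close> and inverse matrices over the two rings never have to be
    compared.\<close>
  have conn: "at_0 (parallel_frame_connection ?B e X s p) =
      parallel_frame_connection ?S e0 (at_0 \<circ> X) (at_0 \<circ> s) p"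
    if "\<And>q i. q \<in> T \<Longrightarrow> e i q = axis i 1" "\<And>q i. q \<in> T \<Longrightarrow> e0 i q = axis i 1" "p \<in> T"
    for e e0 X s p
  proof -
    have "parallel_frame_connection ?B e X s p = B.covd X s p"
      unfolding B.covd_def using that by (intro B.parallel_frame_connection_axis) (simp_all add: pts)
    moreover have "parallel_frame_connection ?S e0 (at_0 \<circ> X) (at_0 \<circ> s) p =
        S.covd (at_0 \<circ> X) (at_0 \<circ> s) p"
      unfolding S.covd_def using that by (intro S.parallel_frame_connection_axis) (simp_all add: pts)
    ultimately show ?thesis by (simp add: covd_at_0[OF T])
  qed
  have cotangent: "cotangent_bundle b = tangent_bundle b" for b :: "('m, 'n, 'c::comm_ring_1) base"
    by (simp add: cotangent_bundle_def tangent_bundle_def)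
  have "at_0 (affine_connection ?B X s p) = affine_connection ?S (at_0 \<circ> X) (at_0 \<circ> s) p"
    if "p \<in> T" for X s p
    unfolding affine_connection_def using that by (intro conn) simp_all
  moreover have "at_0 (parallel_frame_connection ?B (dual_coframe ?B G) X s p) =
      parallel_frame_connection ?S (dual_coframe ?S (\<lambda>p. fps_nth (G p) 0)) (at_0 \<circ> X) (at_0 \<circ> s) p"
    if "p \<in> T" for X s p
    using that coframe coframe0 by (intro conn)
  ultimately show ?thesis
    unfolding legendre_restricts_at_0_def connection_restricts_at_0_def
    using restricts_at_0_tangent_bundle[OF T, where ?'k = 'k]
    by (simp add: legendre_bundle_def pts case_prod_beta fps_sum_nth
        at_0_def[of "fst _"] at_0_def[of "snd _"] cotangent)
qed

text \<open>The form is the pairing with its first argument twisted by \<open>J\<close>.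
  Compatibility of the pairing is known only on fibres, and \<open>uminus\<close> keeps the twisted
  argument inside.\<close>

lemma pk_restricts_at_0_associated_pk:
  assumes "legendre_restricts_at_0 B L L0"
    and uminus: "\<And>p v. p \<in> points B \<Longrightarrow> v \<in> fibre (H_minus L) p \<Longrightarrow> - v \<in> fibre (H_minus L) p"
  shows "pk_restricts_at_0 B (map_prod at_0 at_0) (associated_pk L) (associated_pk L0)"
proof -
  let ?E = "direct_sum (H_plus L) (H_minus L)"
  let ?r = "map_prod at_0 at_0"
  have L: "restricts_at_0 B at_0 (H_plus L) (H_plus L0)" "restricts_at_0 B at_0 (H_minus L) (H_minus L0)"
    "connection_restricts_at_0 B at_0 (H_plus L) (nabla_plus L) (nabla_plus L0)"
    "connection_restricts_at_0 B at_0 (H_minus L) (nabla_minus L) (nabla_minus L0)"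
    and pairing: "\<And>p v w. p \<in> points B \<Longrightarrow> v \<in> fibre ?E p \<Longrightarrow> w \<in> fibre ?E p \<Longrightarrow>
      fps_nth (l_pairing L p v w) 0 = l_pairing L0 p (?r v) (?r w)"
    using assms(1) unfolding legendre_restricts_at_0_def by blast+
  have J_mem: "(fst v, - snd v) \<in> fibre ?E p" if "p \<in> points B" "v \<in> fibre ?E p" for v p
    using that uminus by (auto simp: direct_sum_def)
  have "connection_restricts_at_0 B ?r ?E (pk_conn (associated_pk L)) (pk_conn (associated_pk L0))"
    using L(3,4) unfolding connection_restricts_at_0_def
    by (simp add: direct_sum_def associated_pk_def o_def)
  moreover have "?r (pk_J (associated_pk L) p v) = pk_J (associated_pk L0) p (?r v)" for p v
    by (cases v) (simp add: associated_pk_def at_0_def vec_eq_iff)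
  moreover have "fps_nth (pk_omega (associated_pk L) p v w) 0 =
      pk_omega (associated_pk L0) p (?r v) (?r w)"
    if p: "p \<in> points B" and v: "v \<in> fibre ?E p" and w: "w \<in> fibre ?E p" for p v w
  proof -
    have "fps_nth (l_pairing L p (fst v, - snd v) w) 0 = l_pairing L0 p (?r (fst v, - snd v)) (?r w)"
      by (rule pairing[OF p J_mem[OF p v] w])
    also have "?r (fst v, - snd v) = (fst (?r v), - snd (?r v))"
      by (cases v) (simp add: at_0_def vec_eq_iff)
    finally show ?thesis
      by (simp add: associated_pk_def case_prod_beta)
  qed
  moreover have "pk_bundle (associated_pk L) = ?E"
    "pk_bundle (associated_pk L0) = direct_sum (H_plus L0) (H_minus L0)"
    by (simp_all add: associated_pk_def)
  ultimately show ?thesis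
    unfolding pk_restricts_at_0_def using restricts_at_0_direct_sum[OF L(1,2)] by simp
qed

theorem corollary1:
  fixes T :: "'m set"
    and t :: "'m \<Rightarrow> real^'n::finite"
    and F :: "'m \<Rightarrow> real fps"
    and L :: "('m, 'n, 'k::{real_normed_field, euclidean_space} fps) legendre_data"
    and L0 :: "('m, 'n, 'k) legendre_data"
  assumes "hessian_qft T t F"
  defines "L \<equiv> legendre_family T t F"
    and "L0 \<equiv> tree_level_legendre_bundle T t F"
  shows "para_kaehler_bundle (formal_base T t) (associated_pk L)
    \<and> para_kaehler_bundle (smooth_base T t) (associated_pk L0)
    \<and> legendre_restricts_at_0 (formal_base T t) L L0
    \<and> pk_restricts_at_0 (formal_base T t) (map_prod at_0 at_0) (associated_pk L) (associated_pk L0)"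
proof -
  let ?B = "formal_base T t :: ('m, 'n, 'k fps) base" and ?S = "smooth_base T t :: ('m, 'n, 'k) base"
  let ?G = "\<lambda>p. Abs_fps (\<lambda>m. of_real (fps_nth (F p) m) :: 'k)"
  \<comment> \<open>Written as the constant term of \<open>?G\<close> to fit the restriction lemma;
    it simplifies to the potential in the definition of the tree-level bundle.\<close>
  let ?Gz = "\<lambda>p. fps_nth (?G p) 0"
  have T: "inj_on t T" "open (t ` T)" and F: "(\<lambda>p. fps_nth (F p) m) \<in> smooth (smooth_base T t) T" for m
    using assms(1) by (simp_all add: hessian_qft_def formal_base_def)
  have L: "L = legendre_bundle ?B ?G" and L0: "L0 = legendre_bundle ?S ?Gz"
    by (simp_all add: L_def L0_def legendre_family_def tree_level_legendre_bundle_def)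
  have hess: "invertible (hessian ?B ?G p)" if p: "p \<in> T" for p
  proof -
    \<comment> \<open>Coefficientwise \<open>of_real\<close> is a ring homomorphism, so the inverse
      obtained over \<open>real fps\<close> passes to \<open>'k fps\<close>.\<close>
    let ?h = "\<lambda>x :: real fps. Abs_fps (\<lambda>m. of_real (fps_nth x m) :: 'k)"
    have "hessian ?B ?G p = (\<chi> i j. ?h (hessian (formal_base T t) F p $ i $ j))"
      using p by (simp add: vec_eq_iff fps_eq_iff hessian_formal_base hessian_of_real[OF T F])
    moreover have "invertible (\<chi> i j. ?h (hessian (formal_base T t) F p $ i $ j))"
      by (rule invertible_map_matrix[OF _ _ _ _ hessian_qft_invertible[OF assms(1) p]])
        (simp_all add: fps_eq_iff fps_mult_nth)
    ultimately show ?thesis by simp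
  qed
  have hess0: "invertible (hessian ?S ?Gz p)" if p: "p \<in> T" for p
  proof -
    \<comment> \<open>The tree-level Hessian is the constant term of the formal one, so it inherits
      invertibility by reduction at \<open>u = 0\<close>.\<close>
    have "hessian ?S ?Gz p = (\<chi> i j. fps_nth (hessian ?B ?G p $ i $ j) 0)"
      by (simp add: vec_eq_iff hessian_formal_base)
    moreover have "invertible (\<chi> i j. fps_nth (hessian ?B ?G p $ i $ j) 0)"
      by (rule invertible_map_matrix[OF _ _ _ _ hess[OF p]]) simp_all
    ultimately show ?thesis by simp
  qed
  have coframe: "dual_coframe ?B ?G i p = axis i 1" "dual_coframe ?S ?Gz i p = axis i 1"
    if "p \<in> T" for p i
    by (rule dual_coframe_eq_axis[OF hess[OF that]], rule dual_coframe_eq_axis[OF hess0[OF that]])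
  have "para_kaehler_bundle ?B (associated_pk L)"
    unfolding L using coframe
    by (intro derivation_base.para_kaehler_legendre_bundle derivation_base_formal_base T)
      (simp add: formal_base_def)
  moreover have "para_kaehler_bundle ?S (associated_pk L0)"
    unfolding L0 using coframe
    by (intro derivation_base.para_kaehler_legendre_bundle derivation_base_smooth_base T)
      (simp add: smooth_base_def)
  moreover have "legendre_restricts_at_0 ?B L L0"
    unfolding L L0 by (intro legendre_restricts_at_0_legendre_bundle T coframe)
  moreover from this have "pk_restricts_at_0 ?B (map_prod at_0 at_0) (associated_pk L) (associated_pk L0)"
    by (rule pk_restricts_at_0_associated_pk) (simp add: L legendre_bundle_def cotangent_bundle_def)
  ultimately show ?thesis by blast
qed

end
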